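(* Let $q\geq 3$ be an integer. There exist constants $C>0$ and $d_0>0$ such that for all integers $d\geq d_0$ and all $\alpha\in(0,1)$ the following holds for any $i\in\{1,\dots,q\}$: $$\lim_{n\to\infty}\ \max_{\tau:\Lambda_n\to[q]}\left|\Pr_{\mathbb{T}^n_{d+1};q,w_c}[\mathbf{\Phi}(r)=i\mid \mathbf{\Phi}\!\restriction_{\Lambda_n}=\tau]-\frac1q\right|=0,$$ where $w_c=\max\{0,1-\tfrac{q}{d+1}\}$; and for every positive integer $n$, every boundary condition $\tau:\Lambda_n\to[q]$ at level $n$, and edge interaction $w(\alpha)=1-\tfrac{\alpha q}{d+1}$, $$\left|\Pr_{\mathbb{T}^n_{d+1};q,w(\alpha)}[\mathbf{\Phi}(r)=i\mid \mathbf{\Phi}\!\restriction_{\Lambda_n}=\tau]-\frac1q\right|\leq C\alpha^{n/2}.$$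
   Context: Write $[q]=\{1,\dots,q\}$. For a finite graph $G=(V,E)$ and $w>0$, the $q$-state Potts measure on maps $\phi:V\to[q]$ is $\Pr_{G;q,w}[\mathbf{\Phi}=\phi]=\dfrac{w^{m(\phi)}}{\sum_{\sigma:V\to[q]}w^{m(\sigma)}}$, where $m(\sigma)$ is the number of edges $\{u,v\}\in E$ with $\sigma(u)=\sigma(v)$. Let $\mathbb{T}_{d+1}$ be the infinite $(d+1)$-regular tree. For a positive integer $n$, $\mathbb{T}^n_{d+1}$ is the finite tree obtained from $\mathbb{T}_{d+1}$ by fixing a root vertex $r$, deleting all vertices at distance more than $n$ from $r$, deleting one of the neighbors of $r$, and keeping the connected component containing $r$ (so $r$ has $d$ children, and every vertex at distance between $1$ and $n-1$ from $r$ has $d$ children). $\Lambda_n$ denotes the set of leaves of $\mathbb{T}^n_{d+1}$ (the vertices at distance $n$ from $r$). A boundary condition at level $n$ is a map $\tau:\Lambda_n\to[q]$. *)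

theory Defs
  imports "HOL-Probability.Probability"
begin

section \<open>Simple graphs\<close>

record 'a ugraph =
  verts :: "'a set"
  edges :: "'a set set"

definition simple_graph :: "'a ugraph \<Rightarrow> bool" where
  "simple_graph G \<longleftrightarrow> (\<forall>e\<in>edges G. \<exists>u v. u \<in> verts G \<and> v \<in> verts G \<and> u \<noteq> v \<and> e = {u, v})"

definition adj :: "'a ugraph \<Rightarrow> 'a \<Rightarrow> 'a \<Rightarrow> bool" where
  "adj G u v \<longleftrightarrow> {u, v} \<in> edges G"

definition vertex_degree :: "'a ugraph \<Rightarrow> 'a \<Rightarrow> nat" where
  "vertex_degree G v = card {e \<in> edges G. v \<in> e}"

text \<open>A walk is given by its list of vertices; \<open>p\<close> has \<open>length p - 1\<close> steps.\<close>

definition walk :: "'a ugraph \<Rightarrow> 'a \<Rightarrow> 'a list \<Rightarrow> 'a \<Rightarrow> bool" where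
  "walk G u p v \<longleftrightarrow>
     p \<noteq> [] \<and> hd p = u \<and> last p = v \<and> set p \<subseteq> verts G \<and> successively (adj G) p"

definition connected_graph :: "'a ugraph \<Rightarrow> bool" where
  "connected_graph G \<longleftrightarrow> verts G \<noteq> {} \<and> (\<forall>u\<in>verts G. \<forall>v\<in>verts G. \<exists>p. walk G u p v)"

definition cycle :: "'a ugraph \<Rightarrow> 'a list \<Rightarrow> bool" where
  "cycle G p \<longleftrightarrow> 3 \<le> length p \<and> distinct p \<and> walk G (hd p) p (last p) \<and> adj G (last p) (hd p)"

definition tree :: "'a ugraph \<Rightarrow> bool" where
  "tree G \<longleftrightarrow> simple_graph G \<and> connected_graph G \<and> (\<nexists>p. cycle G p)"

text \<open>The graph distance; meaningful only for vertices in the same component.\<close>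

definition graph_dist :: "'a ugraph \<Rightarrow> 'a \<Rightarrow> 'a \<Rightarrow> nat" where
  "graph_dist G u v = (LEAST k. \<exists>p. walk G u p v \<and> length p = Suc k)"

definition delete_verts :: "'a ugraph \<Rightarrow> 'a set \<Rightarrow> 'a ugraph" where
  "delete_verts G X = \<lparr>verts = verts G - X, edges = {e \<in> edges G. e \<inter> X = {}}\<rparr>"

definition component :: "'a ugraph \<Rightarrow> 'a \<Rightarrow> 'a ugraph" where
  "component G r = delete_verts G {v. \<nexists>p. walk G r p v}"

section \<open>Regular trees and their truncations\<close>

text \<open>A prefix-closed set of words becomes a tree by joining every nonempty word to the word
  obtained by removing its last letter.\<close>

definition word_graph :: "'b list set \<Rightarrow> 'b list ugraph" where
  "word_graph S = \<lparr>verts = S, edges = {{xs, xs @ [a]} | xs a. xs @ [a] \<in> S}\<rparr>"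

text \<open>A concrete model of the \<open>k\<close>-regular tree: the empty word has the \<open>k\<close> one-letter words as
  neighbours, and every other word has its parent and \<open>k - 1\<close> children. See
  \<open>regular_tree_is_tree\<close>, \<open>regular_tree_degree\<close> and \<open>regular_tree_infinite\<close> below.
  The tree is homogeneous, so the choice of root and deleted neighbour below is immaterial.\<close>

definition regular_tree :: "nat \<Rightarrow> nat list ugraph" where
  "regular_tree k =
     word_graph {xs. xs = [] \<or> (hd xs < k \<and> set (tl xs) \<subseteq> {..<k - 1})}"

definition truncation :: "'a ugraph \<Rightarrow> 'a \<Rightarrow> 'a \<Rightarrow> nat \<Rightarrow> 'a ugraph" where
  "truncation T r s n =
     component (delete_verts (delete_verts T {v. graph_dist T r v > n}) {s}) r"

text \<open>\<open>trunc_tree d n\<close> is the depth-\<open>n\<close> truncation of the \<open>(d + 1)\<close>-regular tree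
  rooted at the empty word, the deleted neighbour of the root being the word \<open>[d]\<close>.\<close>

definition trunc_tree :: "nat \<Rightarrow> nat \<Rightarrow> nat list ugraph" where
  "trunc_tree d n = truncation (regular_tree (d + 1)) [] [d] n"

definition leaves :: "nat \<Rightarrow> nat \<Rightarrow> nat list set" where
  "leaves d n = {v \<in> verts (trunc_tree d n). graph_dist (trunc_tree d n) [] v = n}"

section \<open>The Potts measure\<close>

definition mono_edges :: "'a ugraph \<Rightarrow> ('a \<Rightarrow> nat) \<Rightarrow> nat" where
  "mono_edges G \<sigma> = card {e \<in> edges G. \<exists>u v. e = {u, v} \<and> \<sigma> u = \<sigma> v}"

text \<open>Maps \<open>V \<rightarrow> [q]\<close> are represented by functions that are \<open>undefined\<close> outside \<open>V\<close>, so that there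
  are exactly \<open>q ^ card V\<close> of them.\<close>

definition colourings :: "'a set \<Rightarrow> nat \<Rightarrow> ('a \<Rightarrow> nat) set" where
  "colourings V q = (V \<rightarrow>\<^sub>E {1..q})"

definition potts_prob :: "'a ugraph \<Rightarrow> nat \<Rightarrow> real \<Rightarrow> ('a \<Rightarrow> nat) \<Rightarrow> real" where
  "potts_prob G q w \<phi> =
     w ^ mono_edges G \<phi> / (\<Sum>\<sigma>\<in>colourings (verts G) q. w ^ mono_edges G \<sigma>)"

definition potts_measure :: "'a ugraph \<Rightarrow> nat \<Rightarrow> real \<Rightarrow> ('a \<Rightarrow> nat) measure" where
  "potts_measure G q w = point_measure (colourings (verts G) q) (\<lambda>\<phi>. ennreal (potts_prob G q w \<phi>))"

text \<open>The probability that the root has colour \<open>i\<close>, conditionally on the boundary condition \<open>\<tau>\<close>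
  (an element of \<open>colourings (leaves d n) q\<close>).\<close>

definition root_prob :: "nat \<Rightarrow> nat \<Rightarrow> real \<Rightarrow> nat \<Rightarrow> (nat list \<Rightarrow> nat) \<Rightarrow> nat \<Rightarrow> real" where
  "root_prob d q w n \<tau> i =
     \<P>(\<phi> in potts_measure (trunc_tree d n) q w. \<phi> [] = i \<bar> restrict \<phi> (leaves d n) = \<tau>)"

section \<open>Basic facts\<close>

definition prefix_closed :: "'b list set \<Rightarrow> bool" where
  "prefix_closed S \<longleftrightarrow> [] \<in> S \<and> (\<forall>xs a. xs @ [a] \<in> S \<longrightarrow> xs \<in> S)"

lemma verts_word_graph [simp]: "verts (word_graph S) = S"
  by (simp add: word_graph_def)

lemma adj_word_graph:
  "adj (word_graph S) u v \<longleftrightarrow> (\<exists>a. (v = u @ [a] \<and> v \<in> S) \<or> (u = v @ [a] \<and> u \<in> S))"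
  by (auto simp: adj_def word_graph_def doubleton_eq_iff)

lemma adj_sym: "adj G u v \<Longrightarrow> adj G v u"
  by (simp add: adj_def insert_commute)

lemma walk_rev: "walk G u p v \<Longrightarrow> walk G v (rev p) u"
  unfolding walk_def
  by (auto simp: hd_rev last_rev intro: successively_mono adj_sym)

lemma walk_trans:
  assumes "walk G u p v" "walk G v p' w"
  shows "walk G u (p @ tl p') w"
proof (cases p')
  case Nil
  then show ?thesis using assms by (simp add: walk_def)
next
  case (Cons x xs)
  then show ?thesis using assms
    by (auto simp: walk_def successively_append_iff successively_Cons)
qed

lemma walk_snoc:
  assumes "walk G u p v" "adj G v w" "w \<in> verts G"
  shows "walk G u (p @ [w]) w"
  using assms by (auto simp: walk_def successively_append_iff)

lemma walk_from_root:
  assumes "prefix_closed S" "xs \<in> S"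
  shows "\<exists>p. walk (word_graph S) [] p xs \<and> length p = Suc (length xs)"
  using assms(2)
proof (induction xs rule: rev_induct)
  case Nil
  then show ?case by (intro exI[of _ "[[]]"]) (auto simp: walk_def)
next
  case (snoc a xs)
  then have "xs \<in> S" using assms(1) by (auto simp: prefix_closed_def)
  with snoc obtain p where "walk (word_graph S) [] p xs" "length p = Suc (length xs)" by blast
  then show ?case using snoc.prems
    by (intro exI[of _ "p @ [xs @ [a]]"]) (auto intro!: walk_snoc simp: adj_word_graph)
qed

lemma walk_from_root_length:
  "walk (word_graph S) [] p xs \<Longrightarrow> length xs < length p"
proof (induction p arbitrary: xs rule: rev_induct)
  case Nil
  then show ?case by (simp add: walk_def)
next
  case (snoc y p)
  show ?case
  proof (cases "p = []")
    case True
    then show ?thesis using snoc.prems by (auto simp: walk_def)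
  next
    case False
    then have "walk (word_graph S) [] p (last p)" and a: "adj (word_graph S) (last p) xs"
      using snoc.prems by (auto simp: walk_def successively_append_iff)
    then have "length (last p) < length p" using snoc.IH by blast
    then show ?thesis using a by (auto simp: adj_word_graph)
  qed
qed

lemma graph_dist_word_graph:
  assumes "prefix_closed S" "xs \<in> S"
  shows "graph_dist (word_graph S) [] xs = length xs"
  unfolding graph_dist_def
proof (rule Least_equality)
  show "\<exists>p. walk (word_graph S) [] p xs \<and> length p = Suc (length xs)"
    by (rule walk_from_root[OF assms])
qed (use walk_from_root_length in fastforce)

lemma tree_word_graph:
  assumes "prefix_closed S"
  shows "tree (word_graph S)"
  unfolding tree_def
proof (intro conjI notI)
  show "simple_graph (word_graph S)"
    using assms unfolding simple_graph_def word_graph_def prefix_closed_def by fastforce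
  show "connected_graph (word_graph S)"
    unfolding connected_graph_def
  proof (intro conjI ballI)
    show "verts (word_graph S) \<noteq> {}" using assms by (auto simp: prefix_closed_def)
    fix u v assume "u \<in> verts (word_graph S)" "v \<in> verts (word_graph S)"
    then show "\<exists>p. walk (word_graph S) u p v"
      using walk_from_root[OF assms] walk_rev walk_trans by (metis verts_word_graph)
  qed
next
  assume "\<exists>p. cycle (word_graph S) p"
  then obtain p where p: "cycle (word_graph S) p" by blast
  define k where "k = length p"
  have k: "3 \<le> k" and dist: "distinct p" using p by (auto simp: cycle_def k_def)
  have step: "adj (word_graph S) (p ! i) (p ! (Suc i mod k))" if "i < k" for i
  proof (cases "Suc i < k")
    case True
    then show ?thesis using p
      by (auto simp: cycle_def walk_def k_def successively_conv_nth)
  next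
    case False
    then have "Suc i = k" using that by simp
    then show ?thesis using p k
      by (auto simp: cycle_def walk_def k_def last_conv_nth hd_conv_nth dest!: sym[of "Suc i"])
  qed
  obtain m where m: "m < k" "\<And>i. i < k \<Longrightarrow> length (p ! i) \<le> length (p ! m)"
  proof -
    have "finite ((\<lambda>i. length (p ! i)) ` {..<k})" "(\<lambda>i. length (p ! i)) ` {..<k} \<noteq> {}"
      using k by (auto simp: lessThan_empty_iff)
    from Max_in[OF this] Max_ge[OF this(1)] that show thesis by force
  qed
  define s where "s = Suc m mod k"
  define t where "t = (m + k - 1) mod k"
  have st: "s < k" "t < k" "Suc t mod k = m" "s \<noteq> t"
  proof -
    show "s < k" "t < k" using k by (auto simp: s_def t_def)
    show "Suc t mod k = m" using m(1) k by (cases m) (auto simp: t_def)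
    show "s \<noteq> t"
    proof (cases m)
      case 0
      then show ?thesis using k by (simp add: s_def t_def)
    next
      case (Suc j)
      then have "t = j" using m(1) k by (simp add: t_def)
      moreover have "s = Suc m \<or> s = 0 \<and> Suc m = k"
        using m(1) by (cases "Suc m = k") (auto simp: s_def)
      ultimately show ?thesis using Suc k by auto
    qed
  qed
  have "adj (word_graph S) (p ! m) (p ! s)" using step[OF m(1)] by (simp add: s_def)
  then have "p ! s = butlast (p ! m)" using m(2)[OF st(1)] by (auto simp: adj_word_graph)
  moreover have "adj (word_graph S) (p ! t) (p ! m)" using step[OF st(2)] st(3) by simp
  then have "p ! t = butlast (p ! m)" using m(2)[OF st(2)] by (auto simp: adj_word_graph)
  ultimately have "p ! s = p ! t" by simp
  then show False using dist st by (simp add: nth_eq_iff_index_eq k_def)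
qed

lemma prefix_closed_regular:
  fixes k :: nat
  shows "prefix_closed {xs. xs = [] \<or> (hd xs < k \<and> set (tl xs) \<subseteq> {..<k - 1})}"
proof -
  have "xs = [] \<or> (hd xs < k \<and> set (tl xs) \<subseteq> {..<k - 1})"
    if "hd (xs @ [a]) < k" "set (tl (xs @ [a])) \<subseteq> {..<k - 1}" for xs :: "nat list" and a
    using that by (cases xs) auto
  then show ?thesis by (auto simp: prefix_closed_def)
qed

lemma regular_tree_is_tree: "tree (regular_tree k)"
  unfolding regular_tree_def by (rule tree_word_graph[OF prefix_closed_regular])

lemma regular_tree_degree:
  assumes "xs \<in> verts (regular_tree k)"
  shows "vertex_degree (regular_tree k) xs = k"
proof -
  define S where "S = {xs. xs = [] \<or> (hd xs < k \<and> set (tl xs) \<subseteq> {..<k - 1})}"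
  have xs: "xs \<in> S" using assms by (simp add: regular_tree_def S_def)
  let ?f = "\<lambda>a. {xs, xs @ [a]}"
  have inj: "inj_on ?f A" for A by (auto simp: inj_on_def doubleton_eq_iff)
  have E: "{e \<in> edges (regular_tree k). xs \<in> e} =
      ?f ` {a. xs @ [a] \<in> S} \<union> (if xs = [] then {} else {{butlast xs, xs}})"
  proof (rule set_eqI, rule iffI)
    fix e assume "e \<in> {e \<in> edges (regular_tree k). xs \<in> e}"
    then show "e \<in> ?f ` {a. xs @ [a] \<in> S} \<union> (if xs = [] then {} else {{butlast xs, xs}})"
      by (auto simp: regular_tree_def word_graph_def S_def)
  next
    fix e assume "e \<in> ?f ` {a. xs @ [a] \<in> S} \<union> (if xs = [] then {} else {{butlast xs, xs}})"
    then consider a where "e = {xs, xs @ [a]}" "xs @ [a] \<in> S"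
      | "xs \<noteq> []" "e = {butlast xs, xs}" by (auto split: if_splits)
    then show "e \<in> {e \<in> edges (regular_tree k). xs \<in> e}"
    proof cases
      case 1
      then show ?thesis by (auto simp: regular_tree_def word_graph_def S_def)
    next
      case 2
      then have "xs = butlast xs @ [last xs]" by simp
      then have "\<exists>ys a. e = {ys, ys @ [a]} \<and> ys @ [a] \<in> S" using 2 xs by metis
      then show ?thesis using 2 by (auto simp: regular_tree_def word_graph_def S_def)
    qed
  qed
  show ?thesis
  proof (cases xs)
    case Nil
    then have "{a. xs @ [a] \<in> S} = {..<k}" by (auto simp: S_def)
    then show ?thesis using E Nil card_image[OF inj[of "{..<k}"]] by (simp add: vertex_degree_def)
  next
    case (Cons y ys)
    then have c: "{a. xs @ [a] \<in> S} = {..<k - 1}" and k: "k \<ge> 1"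
      using xs by (auto simp: S_def)
    have "{butlast xs, xs} \<notin> ?f ` {..<k - 1}"
    proof
      assume "{butlast xs, xs} \<in> ?f ` {..<k - 1}"
      then obtain a where "{butlast xs, xs} = {xs, xs @ [a]}" by blast
      then have "butlast xs = xs @ [a]" by (simp add: doubleton_eq_iff)
      then have "length (butlast xs) = Suc (length xs)" by simp
      then show False by simp
    qed
    then show ?thesis using E c k Cons card_image[OF inj[of "{..<k - 1}"]]
      by (simp add: vertex_degree_def)
  qed
qed

lemma regular_tree_infinite:
  assumes "k \<ge> 2"
  shows "infinite (verts (regular_tree k))"
proof -
  have "range (\<lambda>n. replicate n 0) \<subseteq> verts (regular_tree k)"
  proof (intro subsetI, elim rangeE)
    fix x n assume "x = replicate n (0::nat)"
    then show "x \<in> verts (regular_tree k)"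
      using assms by (cases n) (auto simp: regular_tree_def)
  qed
  moreover have "infinite (range (\<lambda>n. replicate n (0::nat)))"
    by (rule range_inj_infinite) (auto simp: inj_def)
  ultimately show ?thesis using finite_subset by blast
qed

lemma prefix_closed_trunc: "prefix_closed {xs. set xs \<subseteq> {..<d} \<and> length xs \<le> n}"
  by (auto simp: prefix_closed_def)

lemma trunc_tree_eq:
  assumes "n \<ge> 1"
  shows "trunc_tree d n = word_graph {xs. set xs \<subseteq> {..<d} \<and> length xs \<le> n}"
proof -
  define S where "S = {xs. xs = [] \<or> (hd xs < d + 1 \<and> set (tl xs) \<subseteq> {..<d})}"
  define S' where "S' = {xs. set xs \<subseteq> {..<d} \<and> length xs \<le> n}"
  define T where "T = word_graph S"
  have T: "regular_tree (d + 1) = T" by (simp add: regular_tree_def T_def S_def)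
  have pc: "prefix_closed S" using prefix_closed_regular[of "d + 1"] by (simp add: S_def)
  have pc': "prefix_closed S'" using prefix_closed_trunc by (simp add: S'_def)
  define G where "G = delete_verts (delete_verts T {v. graph_dist T [] v > n}) {[d]}"
  have vG: "verts G = {xs \<in> S. length xs \<le> n \<and> xs \<noteq> [d]}"
    by (auto simp: G_def delete_verts_def T_def graph_dist_word_graph[OF pc])
  have prefS: "xs \<in> S" if "xs @ [a] \<in> S" for xs a
    using pc that by (auto simp: prefix_closed_def)
  have eT: "e \<subseteq> S" if "e \<in> edges T" for e
    using that prefS by (auto simp: T_def word_graph_def)
  have eG: "edges G = {e \<in> edges T. e \<subseteq> verts G}"
  proof -
    have "(e \<inter> {v. graph_dist T [] v > n} = {} \<and> e \<inter> {[d]} = {}) \<longleftrightarrow> e \<subseteq> verts G"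
      if "e \<in> edges T" for e
    proof -
      have "verts G = S - {v. graph_dist T [] v > n} - {[d]}"
        by (simp add: G_def delete_verts_def T_def)
      then show ?thesis using eT[OF that] by blast
    qed
    then show ?thesis unfolding G_def delete_verts_def by auto
  qed
  have S'S: "S' \<subseteq> verts G"
  proof
    fix xs assume "xs \<in> S'"
    then show "xs \<in> verts G" by (cases xs) (auto simp: S'_def vG S_def)
  qed
  have child: "xs @ [a] \<in> S'" if "xs \<in> S'" "xs @ [a] \<in> verts G" for xs a
    using that by (cases xs) (auto simp: S'_def vG S_def)
  have stay: "v \<in> S'" if "walk G [] p v" for p v
    using that
  proof (induction p arbitrary: v rule: rev_induct)
    case Nil
    then show ?case by (simp add: walk_def)
  next
    case (snoc y p)
    show ?case
    proof (cases "p = []")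
      case True
      then show ?thesis using snoc.prems by (auto simp: walk_def S'_def)
    next
      case False
      then have "walk G [] p (last p)" and a: "adj G (last p) v" and v: "v \<in> verts G"
        using snoc.prems by (auto simp: walk_def successively_append_iff)
      then have l: "last p \<in> S'" using snoc.IH by blast
      have "adj T (last p) v" using a by (simp add: adj_def eG)
      then consider b where "v = last p @ [b]" | b where "last p = v @ [b]"
        by (auto simp: T_def adj_word_graph)
      then show ?thesis
      proof cases
        case 1
        then show ?thesis using child[OF l] v by simp
      next
        case 2
        then show ?thesis using l pc' unfolding prefix_closed_def by metis
      qed
    qed
  qed
  have VS: "verts G \<subseteq> S" unfolding vG by blast
  have edgeT: "{u, u @ [a]} \<in> edges T" if "u @ [a] \<in> S" for u a
    unfolding T_def word_graph_def ugraph.select_convs mem_Collect_eq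
    by (rule exI[of _ u], rule exI[of _ a]) (simp add: that)
  have edgeG: "{u, u @ [a]} \<in> edges G" if "u @ [a] \<in> S'" for u a
  proof -
    have "u \<in> S'" using pc' that unfolding prefix_closed_def by blast
    then have "u \<in> verts G" "u @ [a] \<in> verts G" using S'S that by blast+
    moreover have "{u, u @ [a]} \<in> edges T" using VS that S'S by (blast intro: edgeT)
    ultimately show ?thesis unfolding eG by blast
  qed
  have adjG: "adj G u v" if "adj (word_graph S') u v" for u v
  proof -
    from that consider a where "v = u @ [a]" "v \<in> S'" | a where "u = v @ [a]" "u \<in> S'"
      unfolding adj_word_graph by blast
    then show ?thesis using edgeG unfolding adj_def by cases (auto simp: insert_commute)
  qed
  have reach: "\<exists>p. walk G [] p v" if v: "v \<in> S'" for v
  proof -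
    obtain p where "walk (word_graph S') [] p v" using walk_from_root[OF pc' v] by blast
    then have "walk G [] p v"
      using S'S unfolding walk_def by (auto intro: successively_mono adjG)
    then show ?thesis by blast
  qed
  have comp: "{v. \<nexists>p. walk G [] p v} = - S'" using stay reach by blast
  have "component G [] = word_graph S'"
  proof -
    have "edges (component G []) = {e \<in> edges T. e \<subseteq> S'}"
      unfolding component_def comp using S'S by (auto simp: delete_verts_def eG)
    also have "\<dots> = edges (word_graph S')"
    proof (intro set_eqI iffI)
      fix e assume "e \<in> {e \<in> edges T. e \<subseteq> S'}"
      then show "e \<in> edges (word_graph S')" by (auto simp: T_def word_graph_def)
    next
      fix e assume "e \<in> edges (word_graph S')"
      then obtain xs a where e: "e = {xs, xs @ [a]}" "xs @ [a] \<in> S'"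
        by (auto simp: word_graph_def)
      then have "xs \<in> S'" "xs @ [a] \<in> S"
        using pc' S'S VS unfolding prefix_closed_def by blast+
      then show "e \<in> {e \<in> edges T. e \<subseteq> S'}" using e edgeT by simp
    qed
    finally have e: "edges (component G []) = edges (word_graph S')" .
    have "verts (component G []) = verts (word_graph S')"
      unfolding component_def comp using S'S by (auto simp: delete_verts_def)
    with e show ?thesis by (simp add: ugraph.equality)
  qed
  then show ?thesis unfolding trunc_tree_def truncation_def T G_def S'_def .
qed

lemma leaves_eq:
  assumes "n \<ge> 1"
  shows "leaves d n = {xs. set xs \<subseteq> {..<d} \<and> length xs = n}"
  unfolding leaves_def trunc_tree_eq[OF assms]
  by (auto simp: graph_dist_word_graph[OF prefix_closed_trunc])

lemma finite_trunc_tree: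
  assumes "n \<ge> 1"
  shows "finite (verts (trunc_tree d n))"
  using finite_lists_length_le[of "{..<d}" n] by (simp add: trunc_tree_eq[OF assms])

lemma prob_space_potts_measure:
  assumes "finite (verts G)" "q \<ge> 1" "w > 0"
  shows "prob_space (potts_measure G q w)"
proof
  define K where "K = colourings (verts G) q"
  define Z where "Z = (\<Sum>\<sigma>\<in>K. w ^ mono_edges G \<sigma>)"
  have fin: "finite K" unfolding K_def colourings_def using assms by (intro finite_PiE) auto
  have ne: "K \<noteq> {}" using assms by (auto simp: K_def colourings_def PiE_eq_empty_iff)
  have Z: "Z > 0" unfolding Z_def using fin ne assms by (intro sum_pos) auto
  have "emeasure (potts_measure G q w) (space (potts_measure G q w))
      = (\<Sum>\<phi>\<in>K. ennreal (potts_prob G q w \<phi>))"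
    unfolding potts_measure_def space_point_measure K_def[symmetric]
    using fin by (intro emeasure_point_measure_finite) auto
  also have "\<dots> = ennreal (\<Sum>\<phi>\<in>K. w ^ mono_edges G \<phi> / Z)"
    using Z assms unfolding potts_prob_def K_def[symmetric] Z_def[symmetric]
    by (intro sum_ennreal) auto
  also have "(\<Sum>\<phi>\<in>K. w ^ mono_edges G \<phi> / Z) = 1"
    using Z by (simp add: sum_divide_distrib[symmetric] Z_def[symmetric])
  finally show "emeasure (potts_measure G q w) (space (potts_measure G q w)) = 1" by simp
qed

end

theory Submission
  imports Defs
begin

text \<open>The law of the colour of a vertex, computed in the subtree below it with the boundary condition imposed,
is written as a density \<open>z\<close> with respect to the uniform law on the \<open>q\<close> colours; averages
over the colours are denoted by \<open>E\<close>, so \<open>E z = 1\<close>. Put \<open>s = sqrt (((d - 1) z + 1) / d)\<close>, the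
amplitude of \<open>z\<close>. Then \<open>E s\<^sup>2 = 1\<close>, and \<open>V = 1 - (E s)\<^sup>2\<close> is the variance of \<open>s\<close>. It vanishes
only for the uniform law, and \<open>\<bar>z i - 1\<bar>\<close> is at most a constant multiple of \<open>sqrt V\<close>
(\<open>density_near_one\<close>). If all children of a vertex have variance at most \<open>V\<close>, then the vertex
has variance at most \<open>\<gamma> V\<close>, where \<open>\<gamma> \<le> \<alpha>\<close> for the interaction \<open>w(\<alpha>)\<close>
and \<open>\<gamma> = (d - 1) / (d - 1 + V)\<close> for the critical one (\<open>contraction_step\<close>). Hence
\<open>V \<le> \<alpha>\<^sup>n\<close> at height \<open>n\<close> in the first case, whose square root is the claimed rate; in the
second case \<open>1 / V\<close> grows by at least \<open>1 / (d - 1)\<close> per level, so \<open>V\<close> tends to \<open>0\<close>.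

The contraction is best seen for \<open>d = \<infinity>\<close>, where \<open>s = sqrt z\<close> and the density at the parent is
proportional to \<open>exp (- \<alpha> z)\<close>, \<open>z\<close> being the average over the children. The parent amplitude
\<open>s'\<close> also has \<open>E s'\<^sup>2 = 1\<close>, so \<open>1 - (E s')\<^sup>2 \<le> E (1 - t s')\<^sup>2\<close> for every \<open>t\<close>; thus the
normalisation of the parent density is immaterial. Write \<open>A = E s\<close> and \<open>s = A + \<sigma>\<close>. A suitable multiple of
\<open>s'\<close> is \<open>exp (- \<alpha> (A \<sigma> + \<sigma>\<^sup>2 / 2)) = exp (- B x - x\<^sup>2 / 2)\<close> with
\<open>x = sqrt \<alpha> \<sigma>\<close> and \<open>B = sqrt \<alpha> A \<le> 1\<close>. For \<open>x \<ge> - B\<close> it differs from \<open>1\<close> by at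
most \<open>\<bar>x\<bar>\<close>: at \<open>B = 1\<close> it equals \<open>1 - x + O(x\<^sup>3)\<close>, so passing to the parent reflects the
amplitude in \<open>1\<close> up to third order. Consequently \<open>E (1 - t s')\<^sup>2 \<le> E x\<^sup>2 = \<alpha> V\<close>.

For finite \<open>d\<close> at the critical interaction the gain is only of order \<open>V\<^sup>2\<close>, so the reflection
must again be exact up to third order. This is what fixes the amplitude: with \<open>sqrt (((d - 1) z + 1) / d)\<close>
in place of \<open>sqrt z\<close> the second order term disappears for every \<open>d\<close>, and the inequality
holds globally (\<open>reflected_square_le\<close> and \<open>le_reflected_square\<close>). Two further effects remain. The children
are different: since \<open>(s - A)\<^sup>2\<close> is a convex function of the logarithm of the message sent to the
parent when \<open>d\<close> is large, they can be replaced by copies of one child (\<open>representative_amplitude\<close>).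
And the new amplitude involves the mean of the unnormalised parent weights, which can be smaller than the
reference value by a fraction of order \<open>1 - A\<close> (\<open>mean_product_ge\<close>); the mixture with the uniform density
dampens this to order \<open>(1 - A) / d\<close>, and it is absorbed by the gain from \<open>B \<le> A\<close> (\<open>reflected_amplitude\<close>).\<close>

section \<open>The reflection inequality\<close>

text \<open>After clearing denominators, the sign of this derivative is that of
\<open>x\<^sup>2 (d + 1 - (d - 1) x)\<close>. The factor \<open>x\<^sup>2\<close> says that the two functions agree up to second order at \<open>0\<close>.\<close>

lemma reflection_log_derivative_nonneg:
  fixes d x :: real
  assumes "d > 1" "x < 1"
    and U: "1 - (2*x + x\<^sup>2) / (d - 1) > 0" and T: "1 - d / (d - 1) * (2*x - x\<^sup>2) > 0"
    and dx: "(d - 1) * x \<le> d + 1"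
  shows "\<exists>D\<ge>0. ((\<lambda>x. d * ln (1 - (2*x + x\<^sup>2) / (d - 1)) - ln (1 - d / (d - 1) * (2*x - x\<^sup>2)))
     has_real_derivative D) (at x)"
proof -
  let ?U = "1 - (2*x + x\<^sup>2) / (d - 1)" and ?T = "1 - d / (d - 1) * (2*x - x\<^sup>2)"
  \<comment> \<open>the derivative is \<open>2 d / (d - 1)\<close> times \<open>(1 - x) / T - (1 + x) / U\<close>, with \<open>U\<close> and \<open>T\<close> the two arguments of \<open>ln\<close>\<close>
  have eq: "(1 - x) * ?U - (1 + x) * ?T = x\<^sup>2 * (d + 1 - (d - 1) * x) / (d - 1)"
    using assms(1) by (simp add: divide_simps) algebra
  have "(1 + x) * ?T \<le> (1 - x) * ?U"
    using eq assms(1) dx by (smt (verit) divide_nonneg_pos mult_nonneg_nonneg zero_le_power2)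
  then have "(1 + x) / ?U \<le> (1 - x) / ?T"
    using U T by (simp only: pos_divide_le_eq times_divide_eq_left pos_le_divide_eq)
  then have nonneg: "0 \<le> 2 * d / (d - 1) * ((1 - x) / ?T - (1 + x) / ?U)"
    using assms(1) by simp
  have "((\<lambda>x. d * ln (1 - (2*x + x\<^sup>2) / (d - 1)) - ln (1 - d / (d - 1) * (2*x - x\<^sup>2)))
     has_real_derivative (d * (inverse ?U * (-(2 + 2*x) / (d - 1))) - inverse ?T * (-(d / (d - 1) * (2 - 2*x))))) (at x)"
  proof -
    have "((\<lambda>x. 1 - (2*x + x\<^sup>2) / (d - 1)) has_real_derivative -(2 + 2*x) / (d - 1)) (at x)"
    proof -
      have "((\<lambda>x. 2*x + x\<^sup>2) has_real_derivative 2 + 2*x) (at x)"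
        by (rule derivative_eq_intros refl | simp)+
      from DERIV_diff[OF DERIV_const[of 1] DERIV_cdivide[OF this, of "d - 1"]]
      show ?thesis by (simp only: minus_divide_left diff_0)
    qed
    from DERIV_chain2[OF DERIV_ln[OF U] this]
    have 1: "((\<lambda>x. ln (1 - (2*x + x\<^sup>2) / (d - 1))) has_real_derivative inverse ?U * (-(2 + 2*x) / (d - 1))) (at x)" .
    have "((\<lambda>x. 1 - d / (d - 1) * (2*x - x\<^sup>2)) has_real_derivative -(d / (d - 1) * (2 - 2*x))) (at x)"
      by (rule derivative_eq_intros refl | simp)+
    from DERIV_chain2[OF DERIV_ln[OF T] this]
    have 2: "((\<lambda>x. ln (1 - d / (d - 1) * (2*x - x\<^sup>2))) has_real_derivative inverse ?T * (-(d / (d - 1) * (2 - 2*x)))) (at x)" .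
    show ?thesis by (rule DERIV_diff[OF DERIV_cmult[OF 1] 2])
  qed
  moreover have "(d * (inverse ?U * (-(2 + 2*x) / (d - 1))) - inverse ?T * (-(d / (d - 1) * (2 - 2*x))))
      = 2 * d / (d - 1) * ((1 - x) / ?T - (1 + x) / ?U)"
    by (simp only: divide_inverse) algebra
  ultimately have "((\<lambda>x. d * ln (1 - (2*x + x\<^sup>2) / (d - 1)) - ln (1 - d / (d - 1) * (2*x - x\<^sup>2)))
     has_real_derivative 2 * d / (d - 1) * ((1 - x) / ?T - (1 + x) / ?U)) (at x)"
    by (simp only:)
  with nonneg show ?thesis by blast
qed

text \<open>The case of a child amplitude \<open>1 + x\<close> above the mean, at the critical interaction: the right-hand side is the
parent weight relative to its value at the uniform law, and the left-hand side is the weight of a parent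
with amplitude \<open>1 - x\<close>. The logarithm of the quotient is \<open>0\<close> at \<open>x = 0\<close> and monotone; where the
left-hand side is not positive there is nothing to prove.\<close>

lemma reflected_square_le:
  fixes x :: real and d :: nat
  assumes "d \<ge> 5" "0 \<le> x" "x < 1"
  shows "1 - d / (real d - 1) * (2*x - x\<^sup>2) \<le> (1 - (2*x + x\<^sup>2) / (real d - 1)) ^ d"
proof (cases "1 - d / (real d - 1) * (2*x - x\<^sup>2) > 0")
  case False
  have "(2*x + x\<^sup>2) / (real d - 1) \<le> 1" using assms power_le_one[of x 2] by (simp add: divide_simps)
  then show ?thesis using False assms by (smt (verit) zero_le_power of_nat_diff of_nat_1)
next
  case True
  let ?F = "\<lambda>x. d * ln (1 - (2*x + x\<^sup>2) / (real d - 1)) - ln (1 - d / (real d - 1) * (2*x - x\<^sup>2))"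
  have U: "1 - (2*y + y\<^sup>2) / (real d - 1) > 0" if "0 \<le> y" "y \<le> x" for y
  proof -
    have "y\<^sup>2 \<le> 1" using that assms by (simp add: power_le_one)
    then show ?thesis using assms that by (simp add: divide_simps)
  qed
  have T: "1 - d / (real d - 1) * (2*y - y\<^sup>2) > 0" if "0 \<le> y" "y \<le> x" for y
  proof -
    have "2*y - y\<^sup>2 \<le> 2*x - x\<^sup>2"
    proof -
      have "(2*x - x\<^sup>2) - (2*y - y\<^sup>2) = (x - y) * (2 - x - y)" by algebra
      moreover have "(x - y) * (2 - x - y) \<ge> 0" using that assms by simp
      ultimately show ?thesis by linarith
    qed
    then have "d / (real d - 1) * (2*y - y\<^sup>2) \<le> d / (real d - 1) * (2*x - x\<^sup>2)"
      using assms by (intro mult_left_mono) auto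
    then show ?thesis using True by linarith
  qed
  have "?F 0 \<le> ?F x"
  proof (rule DERIV_nonneg_imp_nondecreasing[OF assms(2)])
    fix y assume y: "0 \<le> y" "y \<le> x"
    have "(real d - 1) * y \<le> (real d - 1) * 1" using y assms by (intro mult_left_mono) auto
    then have le: "(real d - 1) * y \<le> real d + 1" by simp
    have "1 < real d" "y < 1" using assms y by auto
    from reflection_log_derivative_nonneg[OF this U[OF y] T[OF y] le]
    show "\<exists>D. (?F has_real_derivative D) (at y) \<and> 0 \<le> D" by blast
  qed
  moreover have "0 < 1 - (2*x + x\<^sup>2) / (real d - 1)" using U[of x] assms by simp
  ultimately have "ln (1 - d / (real d - 1) * (2*x - x\<^sup>2)) \<le> ln ((1 - (2*x + x\<^sup>2) / (real d - 1)) ^ d)"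
    by (simp only: ln_realpow) simp
  with True \<open>0 < 1 - (2*x + x\<^sup>2) / (real d - 1)\<close> show ?thesis
    by (subst (asm) ln_le_cancel_iff) (auto simp only: zero_less_power)
qed

text \<open>The mirror image of the preceding lemma, for a child amplitude \<open>1 - x\<close> below the mean.\<close>

lemma le_reflected_square:
  fixes x :: real and d :: nat
  assumes "d \<ge> 5" "0 \<le> x" "x \<le> 1"
  shows "(1 + (2*x - x\<^sup>2) / (real d - 1)) ^ d \<le> 1 + d / (real d - 1) * (2*x + x\<^sup>2)"
proof -
  let ?F = "\<lambda>x. d * ln (1 - (2*x + x\<^sup>2) / (real d - 1)) - ln (1 - d / (real d - 1) * (2*x - x\<^sup>2))"
  have U: "1 - (2*y + y\<^sup>2) / (real d - 1) > 0" if "-1 \<le> y" "y \<le> 0" for y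
  proof -
    have "y * (2 + y) \<le> 0" using that by (simp add: mult_le_0_iff)
    then have "2*y + y\<^sup>2 \<le> 0" by (simp add: power2_eq_square algebra_simps)
    then have "(2*y + y\<^sup>2) / (real d - 1) \<le> 0" using assms by (simp add: divide_le_0_iff)
    then show ?thesis by linarith
  qed
  have T: "1 - d / (real d - 1) * (2*y - y\<^sup>2) > 0" if "y \<le> 0" for y
  proof -
    have "2*y - y\<^sup>2 \<le> 0" using that by (smt (verit) zero_le_power2)
    then have "d / (real d - 1) * (2*y - y\<^sup>2) \<le> 0" using assms by (intro mult_nonneg_nonpos) auto
    then show ?thesis by linarith
  qed
  have "-x \<le> 0" using assms by simp
  then have "?F (-x) \<le> ?F 0"
  proof (rule DERIV_nonneg_imp_nondecreasing)
    fix y assume y: "-x \<le> y" "y \<le> 0"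
    have "(real d - 1) * y \<le> 0" using y assms by (intro mult_nonneg_nonpos) auto
    then have le: "(real d - 1) * y \<le> real d + 1" by simp
    have "1 < real d" "y < 1" "- 1 \<le> y" using assms y by auto
    from reflection_log_derivative_nonneg[OF this(1,2) U[OF this(3) y(2)] T[OF y(2)] le]
    show "\<exists>D. (?F has_real_derivative D) (at y) \<and> 0 \<le> D" by blast
  qed
  moreover have pos: "0 < 1 - (2*(-x) + (-x)\<^sup>2) / (real d - 1)" "0 < 1 - d / (real d - 1) * (2*(-x) - (-x)\<^sup>2)"
    using U[of "-x"] T[of "-x"] assms by auto
  ultimately have "ln ((1 - (2*(-x) + (-x)\<^sup>2) / (real d - 1)) ^ d) \<le> ln (1 - d / (real d - 1) * (2*(-x) - (-x)\<^sup>2))"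
    by (simp only: ln_realpow) simp
  with pos have "(1 - (2*(-x) + (-x)\<^sup>2) / (real d - 1)) ^ d \<le> 1 - d / (real d - 1) * (2*(-x) - (-x)\<^sup>2)"
    by (subst (asm) ln_le_cancel_iff) (auto simp only: zero_less_power)
  also have "1 - (2*(-x) + (-x)\<^sup>2) / (real d - 1) = 1 + (2*x - x\<^sup>2) / (real d - 1)"
    by (simp add: diff_divide_distrib add_divide_distrib)
  also have "1 - d / (real d - 1) * (2*(-x) - (-x)\<^sup>2) = 1 + d / (real d - 1) * (2*x + x\<^sup>2)"
    by (simp add: algebra_simps)
  finally show ?thesis .
qed

lemma power_diff_ge:
  fixes a b :: real
  assumes "0 < b" "b \<le> a" "d \<ge> 1"
  shows "real d * (a - b) * b ^ (d - 1) \<le> a ^ d - b ^ d"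
proof -
  have "1 + real d * (a / b - 1) \<le> (1 + (a / b - 1)) ^ d"
    using assms by (intro Bernoulli_inequality) (auto simp: field_simps)
  then have "b ^ d * (1 + real d * (a / b - 1)) \<le> b ^ d * (a / b) ^ d"
    using assms by (intro mult_left_mono) auto
  also have "\<dots> = a ^ d" using assms by (simp add: power_divide)
  also have "b ^ d * (1 + real d * (a / b - 1)) = b ^ d + real d * (a - b) * b ^ (d - 1)"
    using assms by (cases d) (auto simp: field_simps)
  finally show ?thesis by simp
qed

lemma scaled_power_increment_le:
  fixes X \<theta> :: real
  assumes "0 \<le> X" "1 \<le> \<theta>"
  shows "\<theta> * ((1 + X) ^ d - 1) \<le> (1 + \<theta> * X) ^ d - 1"
proof (induction d)
  case (Suc d)
  have "\<theta> * ((1 + X) ^ Suc d - 1) = (1 + X) * (\<theta> * ((1 + X) ^ d - 1)) + \<theta> * X"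
    by (simp add: algebra_simps)
  also have "\<dots> \<le> (1 + X) * ((1 + \<theta> * X) ^ d - 1) + \<theta> * X"
    using Suc assms by (intro add_right_mono mult_left_mono) auto
  also have "\<dots> \<le> (1 + \<theta> * X) * ((1 + \<theta> * X) ^ d - 1) + \<theta> * X"
    using assms by (intro add_right_mono mult_right_mono) (auto simp: mult_le_cancel_right1)
  also have "\<dots> = (1 + \<theta> * X) ^ Suc d - 1" by (simp add: algebra_simps)
  finally show ?case .
qed simp

text \<open>Here \<open>W\<close> is the weight of a colour at the parent relative to a child of amplitude \<open>A\<close>, where
\<open>B = A sqrt \<gamma>\<close> and \<open>x\<close> is the rescaled deviation of the child, and \<open>k\<close> is the mean of \<open>W\<close>. For \<open>B = k = 1\<close> the
statement is the reflection inequality. A value \<open>k < 1\<close> enlarges \<open>W - 1\<close> by the factor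
\<open>\<theta> = 1 + O((1 - B) / d)\<close>, which is compensated by the decrease of \<open>2 B x\<close> from \<open>2 x\<close>.
For \<open>0 \<le> x < 1\<close> the loss is at most \<open>3 (\<theta> - 1) x\<close> and the gain at least \<open>2 (1 - B) x / 729\<close>, up to a
common factor; \<open>d \<ge> 12000\<close> makes \<open>\<theta> - 1\<close> small enough for the gain to win.\<close>

lemma reflected_amplitude:
  fixes d :: nat and x B k :: real
  assumes d: "d \<ge> 12000" and B: "0 \<le> B" "B \<le> 1" and x: "- B \<le> x"
    and k: "0 < k" "1 - k \<le> 5 * (1 - B)"
    and X: "(2*B*x + x\<^sup>2) / (real d - 1) \<le> 1"
  defines "W \<equiv> (1 - (2*B*x + x\<^sup>2) / (real d - 1)) ^ d"
  shows "(1 - sqrt (((real d - 1) * W + k) / (real d - 1 + k)))\<^sup>2 \<le> x\<^sup>2"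
proof -
  define \<theta> where "\<theta> = real d / (real d - 1 + k)"
  define S where "S = sqrt (((real d - 1) * W + k) / (real d - 1 + k))"
  have W0: "0 \<le> W" unfolding W_def using X by simp
  have S0: "0 \<le> S" unfolding S_def using d k W0 by simp
  have S2: "S\<^sup>2 = 1 + (real d - 1) / real d * (\<theta> * (W - 1))"
  proof -
    have "S\<^sup>2 = ((real d - 1) * W + k) / (real d - 1 + k)"
      unfolding S_def using d k W0 by (intro real_sqrt_pow2 divide_nonneg_nonneg) auto
    also have "\<dots> = 1 + (real d - 1) / real d * (\<theta> * (W - 1))"
      unfolding \<theta>_def using d k by (simp add: divide_simps) algebra
    finally show ?thesis .
  qed
  have \<theta>0: "0 < \<theta>" unfolding \<theta>_def using d k by simp
  have \<theta>1: "\<theta> - 1 \<le> (1 - B) / 2200"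
  proof -
    have "\<theta> - 1 = (1 - k) / (real d - 1 + k)"
      unfolding \<theta>_def using d k by (simp add: divide_simps)
    also have "\<dots> \<le> 5 * (1 - B) / (real d - 1 + k)"
      using d k by (intro divide_right_mono) auto
    also have "\<dots> \<le> 5 * (1 - B) / 11000"
      using d k B by (intro divide_left_mono) auto
    finally show ?thesis by simp
  qed
  have "\<bar>1 - S\<bar> \<le> \<bar>x\<bar>"
  proof (cases "x \<ge> 0")
    case True
    then have "0 \<le> (2*B*x + x\<^sup>2) / (real d - 1)" using d B by simp
    then have W1: "W \<le> 1" unfolding W_def using X by (simp add: power_le_one)
    have "S\<^sup>2 \<le> 1" unfolding S2 using \<theta>0 W1 d by (simp add: mult_nonneg_nonpos divide_nonpos_nonneg zero_le_divide_iff)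
    then have S1: "S \<le> 1" using S0 by (simp add: power_le_one_iff)
    show ?thesis
    proof (cases "x \<ge> 1")
      case True
      then show ?thesis using S0 S1 by simp
    next
      case False
      define X where "X = (2*B*x + x\<^sup>2) / (real d - 1)"
      define X' where "X' = (2*x + x\<^sup>2) / (real d - 1)"
      have xx: "x\<^sup>2 \<le> x" using True False by (simp add: power2_eq_square mult_left_le)
      have X'3: "X' \<le> 3 / (real d - 1)"
        unfolding X'_def using d xx False by (intro divide_right_mono) auto
      have "3 / (real d - 1) \<le> 1/2" using d by (simp add: divide_simps)
      with X'3 have X'h: "X' \<le> 1/2" by linarith
      have X'0: "0 \<le> X'" unfolding X'_def using True d by simp
      have XX': "X' - X = 2 * (1 - B) * x / (real d - 1)"
        unfolding X_def X'_def by (simp add: diff_divide_distrib[symmetric] algebra_simps)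
      have XleX': "X \<le> X'"
      proof -
        have "0 \<le> 2 * (1 - B) * x / (real d - 1)" using B True d by simp
        then show ?thesis using XX' by linarith
      qed
      \<comment> \<open>a lower bound for the slope of the power between \<open>1 - X'\<close> and \<open>1 - X\<close>, with \<open>729 = 3\<^sup>6\<close>\<close>
      have "1/729 \<le> (1 - X') ^ (d - 1)"
      proof -
        have "exp (1::real) \<le> 3" by (rule exp_le)
        then have "exp (1::real) ^ 6 \<le> 3 ^ 6" by (intro power_mono) auto
        then have "exp (6::real) \<le> 729" by (simp add: exp_of_nat_mult[symmetric] flip: exp_of_nat_mult)
        then have "1/729 \<le> exp (- 6 :: real)" by (simp add: exp_minus field_simps)
        also have "\<dots> \<le> exp (- (2 * X') * real (d - 1))"
          using X'3 d by (simp add: field_simps of_nat_diff)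
        also have "\<dots> = exp (- (2 * X')) ^ (d - 1)"
          by (rule exp_of_nat2_mult)
        also have "\<dots> \<le> (1 - X') ^ (d - 1)"
        proof (intro power_mono)
          have "exp (2 * X') \<ge> 1 + 2 * X'" by (rule exp_ge_add_one_self)
          then have "exp (- (2 * X')) \<le> 1 / (1 + 2 * X')" using X'0 by (simp add: exp_minus field_simps)
          also have "\<dots> \<le> 1 - X'"
          proof -
            have "1 \<le> (1 - X') * (1 + 2 * X')" using X'0 X'h mult_left_mono[of "X'" "1/2" "X'"] by (simp add: algebra_simps)
            then show ?thesis using X'0 by (simp add: field_simps)
          qed
          finally show "exp (- (2 * X')) \<le> 1 - X'" .
        qed simp
        finally show ?thesis .
      qed
      then have "real d * (2 * (1 - B) * x / (real d - 1)) * (1/729) \<le> real d * (2 * (1 - B) * x / (real d - 1)) * (1 - X') ^ (d - 1)"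
        using B True d by (intro mult_left_mono) auto
      also have "\<dots> \<le> W - (1 - X') ^ d"
        using power_diff_ge[of "1 - X'" "1 - X" d] XleX' X'h d
        unfolding W_def X_def[symmetric] XX'[symmetric] by (simp add: algebra_simps)
      \<comment> \<open>gain from \<open>B < 1\<close>, to be compared with the loss from \<open>\<theta> > 1\<close>\<close>
      finally have gain: "real d / (real d - 1) * (2 * (1 - B) * x / 729) \<le> W - (1 - X') ^ d" by simp
      have loss: "(\<theta> - 1) * (1 - W) \<le> real d / (real d - 1) * ((1 - B) * 3 * x / 2200)"
      proof -
        have "1 - real d * X \<le> W"
          using Bernoulli_inequality[of "- X" d] X'h XleX' unfolding W_def X_def[symmetric] by simp
        then have "1 - W \<le> real d * X" by simp
        also have "\<dots> \<le> real d * X'" using XleX' by (simp add: mult_left_mono)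
        also have "\<dots> \<le> real d * (3 * x / (real d - 1))"
          unfolding X'_def using xx d by (intro mult_left_mono divide_right_mono) auto
        finally have "1 - W \<le> real d * (3 * x / (real d - 1))" .
        then have le: "(1 - B) / 2200 * (1 - W) \<le> (1 - B) / 2200 * (real d * (3 * x / (real d - 1)))"
          using B by (intro mult_left_mono) auto
        have aux: "b / 2200 * (r * (3 * x / m)) = r / m * (b * 3 * x / 2200)" for b r m :: real
          by (simp add: mult_ac)
        note le
        moreover have "(1 - B) / 2200 * (real d * (3 * x / (real d - 1))) = real d / (real d - 1) * ((1 - B) * 3 * x / 2200)"
          by (rule aux)
        moreover have "(\<theta> - 1) * (1 - W) \<le> (1 - B) / 2200 * (1 - W)"
          using \<theta>1 W1 by (intro mult_right_mono) auto
        ultimately show ?thesis by linarith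
      qed
      have "real d / (real d - 1) * ((1 - B) * 3 * x / 2200) \<le> real d / (real d - 1) * (2 * (1 - B) * x / 729)"
      proof (rule mult_left_mono)
        have "0 \<le> (1 - B) * x" using B True by simp
        then show "(1 - B) * 3 * x / 2200 \<le> 2 * (1 - B) * x / 729" by (simp add: field_simps)
      qed (use d in auto)
      moreover have "(\<theta> - 1) * (1 - W) = \<theta> * (1 - W) - (1 - W)" by algebra
      ultimately have "\<theta> * (1 - W) \<le> 1 - (1 - X') ^ d" using loss gain by linarith
      also have "\<dots> \<le> real d / (real d - 1) * (2*x - x\<^sup>2)"
        using reflected_square_le[of d x] d True False unfolding X'_def by simp
      finally have "(real d - 1) / real d * (\<theta> * (1 - W)) \<le> (real d - 1) / real d * (real d / (real d - 1) * (2*x - x\<^sup>2))"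
        using d by (intro mult_left_mono) auto
      also have "\<dots> = 2*x - x\<^sup>2" using d by simp
      finally have "(real d - 1) / real d * (\<theta> * (1 - W)) \<le> 2*x - x\<^sup>2" .
      moreover have "(real d - 1) / real d * (\<theta> * (W - 1)) = - ((real d - 1) / real d * (\<theta> * (1 - W)))" by algebra
      moreover have "p \<le> p' \<Longrightarrow> r = - p \<Longrightarrow> 1 - p' \<le> 1 + r" for p p' r :: real by simp
      ultimately have "1 - (2*x - x\<^sup>2) \<le> S\<^sup>2" unfolding S2 by blast
      then have "(1 - x)\<^sup>2 \<le> S\<^sup>2" by (simp add: power2_diff)
      then have "1 - x \<le> S" using S0 by (rule power2_le_imp_le)
      then show ?thesis using S1 True by simp
    qed
  next
    case False
    define t where "t = - x"
    have t: "0 < t" "t \<le> B" using False x by (auto simp: t_def)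
    define Y where "Y = (2*B*t - t\<^sup>2) / (real d - 1)"
    have WY: "W = (1 + Y) ^ d"
    proof -
      have "- (2*B*t - t\<^sup>2) = 2*B*x + x\<^sup>2" by (simp add: t_def power2_eq_square)
      then have "(2*B*x + x\<^sup>2) / (real d - 1) = - Y" unfolding Y_def by (metis minus_divide_left)
      then show ?thesis unfolding W_def by simp
    qed
    have "t * t \<le> B * t" using t by (intro mult_right_mono) auto
    then have Y0: "0 \<le> Y" unfolding Y_def using t d B by (simp add: power2_eq_square)
    then have W1: "1 \<le> W" unfolding WY by simp
    have "1 \<le> S\<^sup>2" unfolding S2 using \<theta>0 W1 d by simp
    then have S1: "1 \<le> S" using S0 power2_le_imp_le[of 1 S] by simp
    have "\<theta> * (W - 1) \<le> real d / (real d - 1) * (2*t + t\<^sup>2)"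
    proof -
      \<comment> \<open>the factor is moved inside the power, where \<open>2 B t\<close> leaves room for it\<close>
      define \<eta> where "\<eta> = max 1 \<theta>"
      have "\<theta> * (W - 1) \<le> \<eta> * (W - 1)" using W1 by (intro mult_right_mono) (auto simp: \<eta>_def)
      also have "\<dots> \<le> (1 + \<eta> * Y) ^ d - 1"
        unfolding WY by (rule scaled_power_increment_le[OF Y0]) (simp add: \<eta>_def)
      also have "\<dots> \<le> (1 + (2*t - t\<^sup>2) / (real d - 1)) ^ d - 1"
      proof -
        have "\<eta> * (2*B - t) \<le> 2 - t"
        proof -
          have "\<eta> - 1 \<le> 1 - B" unfolding \<eta>_def using \<theta>1 B by (auto simp: max_def)
          then have "(\<eta> - 1) * (2*B - t) \<le> (1 - B) * 2"
            using t B by (intro mult_mono) (auto simp: \<eta>_def)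
          then show ?thesis by (simp add: algebra_simps)
        qed
        then have "\<eta> * (2*B - t) * t \<le> (2 - t) * t" using t by (intro mult_right_mono) auto
        then have "\<eta> * (2*B*t - t\<^sup>2) \<le> 2*t - t\<^sup>2" by (simp add: power2_eq_square algebra_simps)
        then have "\<eta> * Y \<le> (2*t - t\<^sup>2) / (real d - 1)"
          unfolding Y_def times_divide_eq_right using d by (intro divide_right_mono) auto
        moreover have "0 \<le> \<eta> * Y" using Y0 by (simp add: \<eta>_def)
        ultimately show ?thesis by (intro diff_right_mono power_mono) auto
      qed
      also have "\<dots> \<le> real d / (real d - 1) * (2*t + t\<^sup>2)"
        using le_reflected_square[of d t] t B d by simp
      finally show ?thesis .
    qed
    then have "(real d - 1) / real d * (\<theta> * (W - 1)) \<le> (real d - 1) / real d * (real d / (real d - 1) * (2*t + t\<^sup>2))"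
      using d by (intro mult_left_mono) auto
    also have "\<dots> = 2*t + t\<^sup>2" using d by simp
    finally have "S\<^sup>2 \<le> 1 + (2*t + t\<^sup>2)" unfolding S2 by (rule add_left_mono)
    also have "\<dots> = (1 + t)\<^sup>2" by (simp add: power2_sum)
    finally have "S\<^sup>2 \<le> (1 + t)\<^sup>2" .
    then have "S \<le> 1 + t" by (rule power2_le_imp_le) (use t in linarith)
    then show ?thesis using S1 False unfolding t_def by linarith
  qed
  then have "(1 - S)\<^sup>2 \<le> x\<^sup>2" by (simp only: abs_le_square_iff)
  then show ?thesis unfolding S_def .
qed

section \<open>Averaging over the children\<close>

text \<open>A child with amplitude \<open>s\<close> sends a message proportional to \<open>exp l = P - s\<^sup>2\<close> to its parent. The second
derivative has the sign of \<open>A (P + s\<^sup>2) - 2 s\<^sup>3\<close>: the concave term \<open>s\<^sup>2\<close> is dominated by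
the convex term \<open>- 2 A s\<close> because \<open>P\<close> is of order at least \<open>d\<close>, while \<open>s\<close> is bounded.\<close>

lemma convex_amplitude_deviation:
  fixes P Q A :: real
  assumes A: "0 < A" and Q: "0 < Q" "Q < P" "2 * Q * sqrt Q \<le> A * P"
  shows "convex_on {ln (P - Q)..<ln P} (\<lambda>l. (sqrt (P - exp l) - A)\<^sup>2)"
proof -
  let ?I = "{ln (P - Q)..<ln P}"
  let ?f = "\<lambda>l. (sqrt (P - exp l) - A)\<^sup>2"
  let ?f' = "\<lambda>l. - exp l + A * exp l / sqrt (P - exp l)"
  let ?f'' = "\<lambda>l. - exp l + A * exp l / sqrt (P - exp l) + A * (exp l)\<^sup>2 / (2 * sqrt (P - exp l) ^ 3)"
  have pos: "P - exp l > 0" if "l \<in> ?I" for l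
    using that Q by (metis atLeastLessThan_iff diff_gt_0_iff_gt exp_ln exp_less_cancel_iff less_trans)
  have leQ: "P - exp l \<le> Q" if "l \<in> ?I" for l
  proof -
    have "exp (ln (P - Q)) \<le> exp l" using that by (subst exp_le_cancel_iff) simp
    then show ?thesis using Q by simp
  qed
  show ?thesis
  proof (rule f''_ge0_imp_convex)
    show "convex ?I" by simp
    fix l assume l: "l \<in> ?I"
    note p = pos[OF l]
    have root: "((\<lambda>l. sqrt (P - exp l)) has_real_derivative (- exp l / (2 * sqrt (P - exp l)))) (at l)"
      using p by (auto intro!: derivative_eq_intros simp: field_simps)
    from DERIV_power[OF DERIV_diff[OF this DERIV_const[of A]], of 2]
    have "(?f has_real_derivative 2 * (- exp l / (2 * sqrt (P - exp l))) * (sqrt (P - exp l) - A)) (at l)"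
      by simp
    moreover have "2 * (- E / (2 * R)) * (R - A) = - E + A * E / R" if "R > 0" for E R :: real
      using that by (simp add: field_simps)
    moreover have "0 < sqrt (P - exp l)" using p by simp
    ultimately show "(?f has_real_derivative ?f' l) (at l)" by (simp only:)
    from DERIV_divide[OF DERIV_cmult[OF DERIV_exp, of A] root]
    have "((\<lambda>l. A * exp l / sqrt (P - exp l)) has_real_derivative
        (A * exp l * sqrt (P - exp l) - A * exp l * (- exp l / (2 * sqrt (P - exp l)))) /
        (sqrt (P - exp l) * sqrt (P - exp l))) (at l)"
      using p by simp
    then have "(?f' has_real_derivative - exp l +
        (A * exp l * sqrt (P - exp l) - A * exp l * (- exp l / (2 * sqrt (P - exp l)))) /
        (sqrt (P - exp l) * sqrt (P - exp l))) (at l)"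
      by (intro DERIV_add DERIV_minus DERIV_exp)
    moreover have key: "(A * E * R - A * E * (- E / (2 * R))) / (R * R) = A * E / R + A * E\<^sup>2 / (2 * R ^ 3)"
      if "R > 0" for E R :: real
      using that by (simp add: divide_simps) algebra
    moreover have "0 < sqrt (P - exp l)" using p by simp
    ultimately show "(?f' has_real_derivative ?f'' l) (at l)" by (simp only: key add.assoc)
    define s where "s = sqrt (P - exp l)"
    have s: "0 < s" "s \<le> sqrt Q" "exp l = P - s\<^sup>2"
      using p leQ[OF l] by (auto simp: s_def)
    have "s ^ 3 \<le> sqrt Q ^ 3" using s by (intro power_mono) auto
    also have "\<dots> = Q * sqrt Q" using Q by (simp add: power3_eq_cube)
    finally have "2 * s ^ 3 \<le> A * P" using Q(3) by simp
    also have "\<dots> \<le> A * (P + s\<^sup>2)" using A by (simp add: mult_left_mono)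
    finally have "0 \<le> exp l * (A * (P + s\<^sup>2) - 2 * s ^ 3) / (2 * s ^ 3)" using s(1) by simp
    also have "\<dots> = ?f'' l" unfolding s_def[symmetric] s(3)
      using s(1) by (simp add: divide_simps) algebra
    finally show "0 \<le> ?f'' l" .
  qed
qed

text \<open>By Jensen's inequality, \<open>d\<close> children act on one colour of the parent like \<open>d\<close> copies of a single child whose
deviation from \<open>A\<close> is no larger in mean square.\<close>

lemma representative_amplitude:
  fixes s :: "nat \<Rightarrow> real" and P Q A :: real
  assumes d: "d > 0" and A: "0 < A" and Q: "0 < Q" "Q < P" "2 * Q * sqrt Q \<le> A * P"
    and s: "\<And>j. j < d \<Longrightarrow> 0 < s j" "\<And>j. j < d \<Longrightarrow> (s j)\<^sup>2 \<le> Q"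
  obtains r where "0 < r" "r\<^sup>2 \<le> Q" "(P - r\<^sup>2) ^ d = (\<Prod>j<d. P - (s j)\<^sup>2)"
    "(r - A)\<^sup>2 \<le> (\<Sum>j<d. (s j - A)\<^sup>2) / d"
proof -
  let ?I = "{ln (P - Q)..<ln P}"
  define l where "l j = ln (P - (s j)\<^sup>2)" for j
  define L where "L = (\<Sum>j<d. (1 / d) *\<^sub>R l j)"
  have p: "0 < P - (s j)\<^sup>2" if "j < d" for j using s(2)[OF that] Q by linarith
  have lI: "l j \<in> ?I" if "j < d" for j
    using p[OF that] s[OF that] Q by (simp add: l_def)
  have conv: "convex_on ?I (\<lambda>l. (sqrt (P - exp l) - A)\<^sup>2)"
    by (rule convex_amplitude_deviation[OF A Q])
  have LI: "L \<in> ?I"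
    unfolding L_def using lI d by (intro convex_sum) auto
  have "(sqrt (P - exp L) - A)\<^sup>2 \<le> (\<Sum>j<d. (1 / d) * (sqrt (P - exp (l j)) - A)\<^sup>2)"
    unfolding L_def using lI d by (intro convex_on_sum[OF _ _ conv]) auto
  also have "\<dots> = (\<Sum>j<d. (1 / d) * (s j - A)\<^sup>2)"
    using p s(1) by (intro sum.cong) (auto simp: l_def less_imp_le)
  also have "\<dots> = (\<Sum>j<d. (s j - A)\<^sup>2) / d" by (simp add: sum_divide_distrib)
  finally have dev: "(sqrt (P - exp L) - A)\<^sup>2 \<le> (\<Sum>j<d. (s j - A)\<^sup>2) / d" .
  have eL: "0 < P - exp L" "P - exp L \<le> Q"
  proof -
    have "exp L < exp (ln P)" using LI by simp
    then show "0 < P - exp L" using Q by simp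
    have "exp (ln (P - Q)) \<le> exp L" using LI by (subst exp_le_cancel_iff) simp
    then show "P - exp L \<le> Q" using Q by simp
  qed
  have "exp L ^ d = exp (real d * L)" by (simp add: exp_of_nat_mult)
  also have "real d * L = (\<Sum>j<d. l j)" using d by (simp add: L_def sum_distrib_left)
  also have "exp \<dots> = (\<Prod>j<d. P - (s j)\<^sup>2)"
    unfolding exp_sum[OF finite_lessThan] using p by (intro prod.cong) (auto simp: l_def)
  finally have "(P - (sqrt (P - exp L))\<^sup>2) ^ d = (\<Prod>j<d. P - (s j)\<^sup>2)" using eL by simp
  then show ?thesis using that[of "sqrt (P - exp L)"] dev eL by simp
qed

section \<open>Densities and their amplitudes\<close>

text \<open>The mixture \<open>((d - 1) z + 1) / d\<close> of \<open>z\<close> with the uniform density, instead of \<open>z\<close> itself, makes the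
recursion at the critical interaction a reflection up to third order.\<close>

definition amplitude :: "nat \<Rightarrow> real \<Rightarrow> real" where
  "amplitude d z = sqrt (((real d - 1) * z + 1) / real d)"

lemma amplitude_square:
  assumes "d \<ge> 1" "0 \<le> z"
  shows "(amplitude d z)\<^sup>2 = ((real d - 1) * z + 1) / real d"
  unfolding amplitude_def using assms by (intro real_sqrt_pow2 divide_nonneg_nonneg add_nonneg_nonneg mult_nonneg_nonneg) auto

lemma amplitude_pos:
  assumes "d \<ge> 1" "0 \<le> z"
  shows "0 < amplitude d z"
  unfolding amplitude_def using assms by (intro real_sqrt_gt_zero divide_pos_pos add_nonneg_pos mult_nonneg_nonneg) auto

text \<open>Densities with respect to the uniform probability on \<open>I\<close>, hence with total mass \<open>card I\<close>.\<close>

definition density :: "'a set \<Rightarrow> ('a \<Rightarrow> real) \<Rightarrow> bool" where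
  "density I z \<longleftrightarrow> (\<forall>i\<in>I. 0 \<le> z i) \<and> (\<Sum>i\<in>I. z i) = card I"

lemma density_le_card:
  assumes "finite I" "density I z" "i \<in> I"
  shows "z i \<le> card I"
  using assms member_le_sum[of i I z] by (auto simp: density_def)

lemma amplitude_square_le:
  assumes "finite I" "density I z" "i \<in> I" "d \<ge> 1"
  shows "(amplitude d (z i))\<^sup>2 \<le> card I"
proof -
  have z: "0 \<le> z i" "z i \<le> card I" using assms density_le_card[of I z i] by (auto simp: density_def)
  have c: "1 \<le> real (card I)" using assms(1,3) by (metis One_nat_def Suc_leI card_gt_0_iff empty_iff of_nat_1 of_nat_le_iff)
  have "(real d - 1) * z i + 1 \<le> (real d - 1) * card I + card I"
    using z c assms(4) by (intro add_mono mult_left_mono) auto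
  then show ?thesis using z assms(4) by (simp add: amplitude_square divide_simps algebra_simps)
qed

lemma sum_amplitude_square:
  assumes "density I z" "d \<ge> 1"
  shows "(\<Sum>i\<in>I. (amplitude d (z i))\<^sup>2) = card I"
proof -
  have "(\<Sum>i\<in>I. (amplitude d (z i))\<^sup>2) = (\<Sum>i\<in>I. ((real d - 1) * z i + 1) / real d)"
    using assms by (intro sum.cong) (auto simp: amplitude_square density_def)
  also have "\<dots> = ((real d - 1) * (\<Sum>i\<in>I. z i) + card I) / real d"
    by (simp add: sum_divide_distrib[symmetric] sum.distrib sum_distrib_left)
  also have "\<dots> = card I" using assms by (simp add: density_def field_simps)
  finally show ?thesis .
qed

lemma sum_deviation:
  fixes s :: "'a \<Rightarrow> real" and c :: real
  assumes "(\<Sum>i\<in>I. (s i)\<^sup>2) = card I"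
  shows "(\<Sum>i\<in>I. (s i - c)\<^sup>2) = card I * (1 + c\<^sup>2) - 2 * c * (\<Sum>i\<in>I. s i)"
proof -
  have "(\<Sum>i\<in>I. (s i - c)\<^sup>2) = (\<Sum>i\<in>I. (s i)\<^sup>2 + c\<^sup>2 - 2 * c * s i)"
    by (intro sum.cong) (auto simp: power2_diff mult_ac)
  also have "\<dots> = (\<Sum>i\<in>I. (s i)\<^sup>2) + card I * c\<^sup>2 - 2 * c * (\<Sum>i\<in>I. s i)"
    by (simp add: sum.distrib sum_subtractf sum_distrib_left)
  finally show ?thesis using assms by (simp add: distrib_left)
qed

text \<open>In the space of functions with the normalised inner product, \<open>s\<close> is a unit vector and its mean is the cosine
of its angle with the constant \<open>1\<close>. The sine of that angle is at most the distance from \<open>1\<close> to any point of the line spanned by \<open>s\<close>.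
Since \<open>t\<close> is arbitrary, \<open>s\<close> may be replaced by an unnormalised vector.\<close>

lemma sum_ge_of_scaled_deviation:
  fixes s :: "'a \<Rightarrow> real" and t e :: real
  assumes I: "finite I" "I \<noteq> {}" and s: "\<And>i. i \<in> I \<Longrightarrow> 0 \<le> s i" "(\<Sum>i\<in>I. (s i)\<^sup>2) = card I"
    and dev: "(\<Sum>i\<in>I. (1 - t * s i)\<^sup>2) \<le> card I * e"
  shows "card I * sqrt (1 - e) \<le> (\<Sum>i\<in>I. s i)"
proof -
  define a where "a = (\<Sum>i\<in>I. s i) / card I"
  have c: "0 < real (card I)" using I by (simp add: card_gt_0_iff)
  have a0: "0 \<le> a" unfolding a_def using s(1) by (intro divide_nonneg_nonneg sum_nonneg) auto
  have "(\<Sum>i\<in>I. (1 - t * s i)\<^sup>2) = (\<Sum>i\<in>I. 1 + t\<^sup>2 * (s i)\<^sup>2 - 2 * t * s i)"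
    by (intro sum.cong) (auto simp: power2_diff power_mult_distrib mult_ac)
  also have "\<dots> = card I + t\<^sup>2 * card I - 2 * t * (\<Sum>i\<in>I. s i)"
    using s(2) by (simp add: sum.distrib sum_subtractf sum_distrib_left[symmetric])
  also have "\<dots> = card I * (1 + t\<^sup>2 - 2 * t * a)" unfolding a_def using c by (simp add: field_simps)
  finally have "1 + t\<^sup>2 - 2 * t * a \<le> e" using dev c by simp
  moreover have "0 \<le> (t - a)\<^sup>2" by simp
  ultimately have "1 - e \<le> a\<^sup>2" unfolding power2_diff by linarith
  then have "sqrt (1 - e) \<le> a" using a0 by (rule real_le_lsqrt[OF _ _, rotated]) 
  then show ?thesis unfolding a_def using c by (simp add: field_simps)
qed

text \<open>Bounding \<open>1 - a\<close> below by \<open>exp (- a - 2 a\<^sup>2)\<close> turns the product into a sum, in which the first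
order terms cancel on average although different factors may be correlated arbitrarily.\<close>

lemma sum_prod_ge:
  fixes a :: "nat \<Rightarrow> 'a \<Rightarrow> real"
  assumes I: "finite I" and a: "\<And>j i. j < d \<Longrightarrow> i \<in> I \<Longrightarrow> \<bar>a j i\<bar> \<le> 1/2"
    and mean: "\<And>j. j < d \<Longrightarrow> (\<Sum>i\<in>I. a j i) = 0"
  shows "card I - 2 * (\<Sum>j<d. \<Sum>i\<in>I. (a j i)\<^sup>2) \<le> (\<Sum>i\<in>I. \<Prod>j<d. 1 - a j i)"
proof -
  have "1 - (\<Sum>j<d. a j i + 2 * (a j i)\<^sup>2) \<le> (\<Prod>j<d. 1 - a j i)" if i: "i \<in> I" for i
  proof -
    have "1 - (\<Sum>j<d. a j i + 2 * (a j i)\<^sup>2) \<le> exp (\<Sum>j<d. - (a j i + 2 * (a j i)\<^sup>2))"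
      using exp_ge_add_one_self[of "- (\<Sum>j<d. a j i + 2 * (a j i)\<^sup>2)"] by (simp only: sum_negf)
    also have "\<dots> = (\<Prod>j<d. exp (- (a j i + 2 * (a j i)\<^sup>2)))" by (rule exp_sum) simp
    also have "\<dots> \<le> (\<Prod>j<d. 1 - a j i)"
    proof (intro prod_mono conjI)
      fix j assume "j \<in> {..<d}"
      then have b: "\<bar>- a j i\<bar> \<le> 1/2" using a[OF _ i] by simp
      then have "\<bar>ln (1 + - a j i) - (- a j i)\<bar> \<le> 2 * (- a j i)\<^sup>2"
        by (rule abs_ln_one_plus_x_minus_x_bound)
      then have "- (a j i + 2 * (a j i)\<^sup>2) \<le> ln (1 - a j i)" by (simp add: abs_le_iff)
      then have "exp (- (a j i + 2 * (a j i)\<^sup>2)) \<le> exp (ln (1 - a j i))" by simp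
      also have "\<dots> = 1 - a j i" using b by (intro exp_ln) auto
      finally show "exp (- (a j i + 2 * (a j i)\<^sup>2)) \<le> 1 - a j i" .
    qed simp
    finally show ?thesis .
  qed
  then have "(\<Sum>i\<in>I. 1 - (\<Sum>j<d. a j i + 2 * (a j i)\<^sup>2)) \<le> (\<Sum>i\<in>I. \<Prod>j<d. 1 - a j i)"
    by (rule sum_mono)
  moreover have "(\<Sum>i\<in>I. \<Sum>j<d. a j i + 2 * (a j i)\<^sup>2) = (\<Sum>j<d. \<Sum>i\<in>I. a j i + 2 * (a j i)\<^sup>2)"
    by (rule sum.swap)
  moreover have "\<dots> = 2 * (\<Sum>j<d. \<Sum>i\<in>I. (a j i)\<^sup>2)"
    using mean by (simp add: sum.distrib sum_distrib_left[symmetric])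
  ultimately show ?thesis by (simp add: sum_subtractf)
qed

text \<open>Each factor is the message of a child relative to that of a child of amplitude \<open>A\<close>, so this bounds below the
mean parent weight \<open>k\<close> required by \<open>reflected_amplitude\<close>. Comparing first with the amplitude
\<open>1\<close> of the uniform law costs at most \<open>4 (1 - A)\<close>; around \<open>1\<close> the squared
amplitudes have mean zero deviation, and the quadratic error is of order \<open>(1 - A) / d\<close>.\<close>

lemma mean_product_ge:
  fixes s :: "nat \<Rightarrow> 'a \<Rightarrow> real" and P A :: real
  assumes I: "finite I" "I \<noteq> {}" and d: "real d \<ge> 64 * card I" "d \<ge> 2" and P: "P \<ge> real d" and A: "0 < A" "A \<le> 1"
    and s: "\<And>j i. j < d \<Longrightarrow> i \<in> I \<Longrightarrow> 0 < s j i" "\<And>j i. j < d \<Longrightarrow> i \<in> I \<Longrightarrow> (s j i)\<^sup>2 \<le> card I"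
    and sq: "\<And>j. j < d \<Longrightarrow> (\<Sum>i\<in>I. (s j i)\<^sup>2) = card I"
    and mean: "\<And>j. j < d \<Longrightarrow> card I * A \<le> (\<Sum>i\<in>I. s j i)"
  shows "1 - 5 * (1 - A) \<le> (\<Sum>i\<in>I. \<Prod>j<d. (P - (s j i)\<^sup>2) / (P - A\<^sup>2)) / card I"
proof -
  define q where "q = real (card I)"
  have q1: "1 \<le> q" unfolding q_def using I by (metis One_nat_def Suc_leI card_gt_0_iff of_nat_1 of_nat_le_iff)
  define a where "a j i = ((s j i)\<^sup>2 - 1) / (P - 1)" for j i
  have d64: "real d \<ge> 64 * q" using d by (simp add: q_def)
  have P1: "P - 1 \<ge> 63 * q" "P - 1 \<ge> real d - 1" using P d64 q1 by auto
  have A2: "A\<^sup>2 \<le> 1" using A by (simp add: power_le_one)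
  have a_half: "\<bar>a j i\<bar> \<le> 1/2" if "j < d" "i \<in> I" for j i
  proof -
    have "\<bar>(s j i)\<^sup>2 - 1\<bar> \<le> q" using s(2)[OF that] q1 zero_le_power2[of "s j i"] unfolding q_def by linarith
    then have "\<bar>a j i\<bar> \<le> q / (P - 1)" unfolding a_def abs_divide using P1 q1 by (auto intro!: divide_right_mono)
    also have "\<dots> \<le> 1/2" using P1 q1 by (simp add: divide_simps)
    finally show ?thesis .
  qed
  have a_mean: "(\<Sum>i\<in>I. a j i) = 0" if "j < d" for j
    unfolding a_def using sq[OF that] by (simp add: sum_divide_distrib[symmetric] sum_subtractf)
  have a_square: "(\<Sum>i\<in>I. (a j i)\<^sup>2) \<le> 8 * q\<^sup>2 * (1 - A) / (P - 1)\<^sup>2" if j: "j < d" for j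
  proof -
    have "(a j i)\<^sup>2 \<le> 4 * q * (s j i - 1)\<^sup>2 / (P - 1)\<^sup>2" if i: "i \<in> I" for i
    proof -
      have "(s j i + 1)\<^sup>2 = 2 * (s j i)\<^sup>2 + 2 - (s j i - 1)\<^sup>2" by algebra
      also have "\<dots> \<le> 4 * q" using s(2)[OF j i] q1 zero_le_power2[of "s j i - 1"] unfolding q_def by linarith
      finally have "(s j i + 1)\<^sup>2 * (s j i - 1)\<^sup>2 \<le> 4 * q * (s j i - 1)\<^sup>2" by (rule mult_right_mono) simp
      moreover have "((s j i)\<^sup>2 - 1)\<^sup>2 = (s j i + 1)\<^sup>2 * (s j i - 1)\<^sup>2" by algebra
      ultimately show ?thesis unfolding a_def power_divide by (intro divide_right_mono) auto
    qed
    then have "(\<Sum>i\<in>I. (a j i)\<^sup>2) \<le> (\<Sum>i\<in>I. 4 * q * (s j i - 1)\<^sup>2 / (P - 1)\<^sup>2)" by (rule sum_mono)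
    also have "\<dots> = 4 * q * (\<Sum>i\<in>I. (s j i - 1)\<^sup>2) / (P - 1)\<^sup>2"
      by (simp add: sum_distrib_left sum_divide_distrib)
    also have "\<dots> \<le> 4 * q * (2 * q * (1 - A)) / (P - 1)\<^sup>2"
      using mean[OF j] q1 unfolding sum_deviation[OF sq[OF j]] q_def
      by (intro divide_right_mono mult_left_mono) (auto simp: algebra_simps)
    also have "\<dots> = 8 * q\<^sup>2 * (1 - A) / (P - 1)\<^sup>2" by (simp add: power2_eq_square)
    finally show ?thesis .
  qed
  have "2 * (\<Sum>j<d. \<Sum>i\<in>I. (a j i)\<^sup>2) \<le> 2 * (\<Sum>j<d. 8 * q\<^sup>2 * (1 - A) / (P - 1)\<^sup>2)"
    using a_square by (intro mult_left_mono sum_mono) auto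
  also have "\<dots> = q * (1 - A) * (16 * q * real d / (P - 1)\<^sup>2)" by (simp add: power2_eq_square)
  also have "\<dots> \<le> q * (1 - A) * 1"
  proof (rule mult_left_mono)
    have "16 * q * real d \<le> 16 * q * (2 * (P - 1))" using P1 q1 d64 by (intro mult_left_mono) auto
    also have "\<dots> = 32 * q * (P - 1)" by simp
    also have "\<dots> \<le> (P - 1) * (P - 1)" using P1 q1 by (intro mult_right_mono) auto
    finally show "16 * q * real d / (P - 1)\<^sup>2 \<le> 1" using P1 q1 by (simp add: power2_eq_square)
  qed (use q1 A in auto)
  finally have small: "2 * (\<Sum>j<d. \<Sum>i\<in>I. (a j i)\<^sup>2) \<le> q * (1 - A)" by simp
  have "q - q * (1 - A) \<le> (\<Sum>i\<in>I. \<Prod>j<d. 1 - a j i)"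
    using sum_prod_ge[of I d a, OF I(1) a_half a_mean] small unfolding q_def by simp
  then have mean_prod: "A \<le> (\<Sum>i\<in>I. \<Prod>j<d. 1 - a j i) / q"
    using q1 by (simp add: field_simps)
  \<comment> \<open>the price for having compared with amplitude \<open>1\<close> instead of \<open>A\<close>\<close>
  define f where "f = ((P - 1) / (P - A\<^sup>2)) ^ d"
  have N: "P - A\<^sup>2 \<ge> P - 1" "P - 1 > 0" using A2 P1 q1 by auto
  have f1: "f \<le> 1" unfolding f_def using N by (intro power_le_one) auto
  have "1 - 4 * (1 - A) \<le> f"
  proof -
    have eq: "(P - 1) / (P - A\<^sup>2) = 1 + - ((1 - A\<^sup>2) / (P - A\<^sup>2))" using N by (simp add: field_simps)
    have "1 + real d * - ((1 - A\<^sup>2) / (P - A\<^sup>2)) \<le> f"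
      unfolding f_def eq using N A2 P1 q1 by (intro Bernoulli_inequality) (auto simp: divide_simps)
    moreover have "real d * ((1 - A\<^sup>2) / (P - A\<^sup>2)) \<le> 4 * (1 - A)"
    proof -
      have "real d / (P - A\<^sup>2) \<le> 2" using N P1 q1 d64 by (simp add: divide_simps)
      moreover have "1 - A\<^sup>2 \<le> 2 * (1 - A)" using zero_le_power2[of "1 - A"] by (simp add: power2_diff)
      ultimately have "real d / (P - A\<^sup>2) * (1 - A\<^sup>2) \<le> 2 * (2 * (1 - A))"
        using A2 by (intro mult_mono) auto
      then show ?thesis by simp
    qed
    ultimately show ?thesis by linarith
  qed
  moreover have "f * (1 - A) \<le> 1 * (1 - A)" using f1 A by (intro mult_right_mono) auto
  ultimately have "1 - 5 * (1 - A) \<le> f * A" by (simp add: algebra_simps)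
  also have "\<dots> \<le> f * ((\<Sum>i\<in>I. \<Prod>j<d. 1 - a j i) / q)"
    using mean_prod N unfolding f_def by (intro mult_left_mono) auto
  also have "\<dots> = (\<Sum>i\<in>I. \<Prod>j<d. (P - (s j i)\<^sup>2) / (P - A\<^sup>2)) / card I"
  proof -
    have "f * (\<Prod>j<d. 1 - a j i) = (\<Prod>j<d. (P - (s j i)\<^sup>2) / (P - A\<^sup>2))" for i
    proof -
      have "f * (\<Prod>j<d. 1 - a j i) = (\<Prod>j<d. (P - 1) / (P - A\<^sup>2) * (1 - a j i))"
        by (simp only: f_def prod.distrib prod_constant card_lessThan)
      also have "\<dots> = (\<Prod>j<d. (P - (s j i)\<^sup>2) / (P - A\<^sup>2))"
        using N by (intro prod.cong) (auto simp: a_def divide_simps)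
      finally show ?thesis .
    qed
    then show ?thesis by (simp add: sum_distrib_left q_def)
  qed
  finally show ?thesis .
qed

section \<open>Contraction along one level of the tree\<close>

text \<open>The main estimate. In terms of the amplitudes \<open>s\<close> of the children, the messages are proportional to
\<open>P - s\<^sup>2\<close>. For each colour the children are replaced by a representative one, to which
\<open>reflected_amplitude\<close> applies; summing over the colours leaves \<open>\<gamma>\<close> times the average of
\<open>E (s - A)\<^sup>2\<close> over the children, and this is at most \<open>\<gamma> (1 - A\<^sup>2) = \<gamma> V\<close>. The bound
\<open>V \<le> 1 - 1 / card I\<close> is satisfied by every density and keeps \<open>A\<close> away from \<open>0\<close>.\<close>

lemma contraction_step:
  fixes z :: "nat \<Rightarrow> 'a \<Rightarrow> real" and \<alpha> V :: real
  assumes I: "finite I" "I \<noteq> {}" and d: "d \<ge> 12000 * (card I)\<^sup>2"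
    and \<alpha>: "0 < \<alpha>" "\<alpha> \<le> 1" and V: "0 \<le> V" "V \<le> 1 - 1 / card I"
    and dens: "\<And>j. j < d \<Longrightarrow> density I (z j)"
    and mean: "\<And>j. j < d \<Longrightarrow> card I * sqrt (1 - V) \<le> (\<Sum>i\<in>I. amplitude d (z j i))"
  defines "y \<equiv> \<lambda>i. \<Prod>j<d. 1 - \<alpha> * z j i / (real d + 1)"
  defines "Y \<equiv> (\<Sum>i\<in>I. y i) / card I"
  defines "\<gamma> \<equiv> (real d - 1) / (((real d)\<^sup>2 - 1 + \<alpha>) / (\<alpha> * real d) - (1 - V))"
  shows "card I * sqrt (1 - \<gamma> * V) \<le> (\<Sum>i\<in>I. amplitude d (y i / Y))"
proof -
  define q where "q = real (card I)"
  define A where "A = sqrt (1 - V)"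
  define P where "P = ((real d)\<^sup>2 - 1 + \<alpha>) / (\<alpha> * real d)"
  define N where "N = P - A\<^sup>2"
  define s where "s j i = amplitude d (z j i)" for j i
  have cI: "card I \<ge> 1" using I by (simp add: Suc_leI card_gt_0_iff)
  then have q1: "1 \<le> q" by (simp add: q_def)
  have "real (12000 * (card I)\<^sup>2) \<le> real d" using d by (simp only: of_nat_le_iff)
  then have dq: "12000 * q\<^sup>2 \<le> real d" by (simp add: q_def)
  have qq: "q \<le> q\<^sup>2" "1 \<le> q\<^sup>2" using q1 self_le_power[of q 2] one_le_power[of q 2] by auto
  have d12: "d \<ge> 12000"
  proof -
    have "12000 \<le> real d" using dq qq by linarith
    then show ?thesis by linarith
  qed
  have dpos: "real d \<ge> 12000" using d12 by simp
  have Vlt: "V < 1" using V q1 unfolding q_def by (smt (verit) divide_pos_pos)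
  have A2: "A\<^sup>2 = 1 - V" unfolding A_def using Vlt by simp
  have A01: "0 < A" "A \<le> 1" unfolding A_def using Vlt V by auto
  have P_ge: "P \<ge> real d"
  proof -
    have "real d * (\<alpha> * real d) \<le> (real d)\<^sup>2 - 1 + \<alpha>"
    proof -
      have "0 \<le> (1 - \<alpha>) * ((real d)\<^sup>2 - 1)" using \<alpha> dpos by (intro mult_nonneg_nonneg) auto
      then show ?thesis by (simp add: algebra_simps power2_eq_square)
    qed
    then show ?thesis unfolding P_def using \<alpha> dpos by (simp add: pos_le_divide_eq)
  qed
  have N_ge: "N \<ge> real d - 1" using P_ge A2 V unfolding N_def by linarith
  have \<gamma>N: "\<gamma> = (real d - 1) / N" unfolding \<gamma>_def N_def P_def A2 ..
  have \<gamma>01: "0 < \<gamma>" "\<gamma> \<le> 1" unfolding \<gamma>N using N_ge dpos by auto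
  have Nd: "\<gamma> / (real d - 1) = 1 / N" unfolding \<gamma>N using dpos N_ge by auto
  have z0: "0 \<le> z j i" "z j i \<le> q" if "j < d" "i \<in> I" for j i
    using dens[OF that(1)] that(2) density_le_card[OF I(1), of "z j"] by (auto simp: density_def q_def)
  have s_pos: "0 < s j i" if "j < d" "i \<in> I" for j i
    unfolding s_def using z0[OF that] d12 by (intro amplitude_pos) auto
  have s_le: "(s j i)\<^sup>2 \<le> q" if "j < d" "i \<in> I" for j i
    unfolding s_def q_def using that dens d12 by (intro amplitude_square_le[OF I(1)]) auto
  have s_sq: "(\<Sum>i\<in>I. (s j i)\<^sup>2) = card I" if "j < d" for j
    unfolding s_def using dens[OF that] d12 by (intro sum_amplitude_square) auto
  have qP: "q < P" using P_ge dq qq by linarith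
  have QP: "2 * q * sqrt q \<le> A * P"
  proof -
    have "1 / q \<le> A\<^sup>2" using V A2 by (simp add: q_def)
    then have "sqrt (1 / q) \<le> A" using A01 by (intro real_le_lsqrt) auto
    moreover have "2 * q\<^sup>2 \<le> P" using P_ge dq qq by linarith
    ultimately have "sqrt (1 / q) * (2 * q\<^sup>2) \<le> A * P" using q1 A01 by (intro mult_mono) auto
    moreover have "sqrt (1 / q) * (2 * q\<^sup>2) = 2 * q * sqrt q"
    proof -
      have "q = sqrt q * sqrt q" using q1 by simp
      then have "sqrt (1 / q) * q = sqrt q" using q1 by (simp add: real_sqrt_divide field_simps)
      then show ?thesis by (simp add: power2_eq_square algebra_simps)
    qed
    ultimately show ?thesis by simp
  qed
  define c where "c = \<alpha> * real d / ((real d - 1) * (real d + 1))"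
  have c0: "0 < c" unfolding c_def using \<alpha> dpos by simp
  \<comment> \<open>the weight of a colour all of whose children have amplitude \<open>A\<close>; \<open>W\<close> and \<open>k\<close> below are relative to it\<close>
  define y0 where "y0 = (c * N) ^ d"
  have y0: "0 < y0" unfolding y0_def using c0 N_ge dpos by simp
  define W where "W i = y i / y0" for i
  have msg: "1 - \<alpha> * z j i / (real d + 1) = c * (P - (s j i)\<^sup>2)" if "j < d" "i \<in> I" for j i
  proof -
    have "(s j i)\<^sup>2 = ((real d - 1) * z j i + 1) / real d"
      unfolding s_def using z0[OF that] d12 by (intro amplitude_square) auto
    moreover have "P - ((real d - 1) * z j i + 1) / real d = (real d - 1) * (real d + 1 - \<alpha> * z j i) / (\<alpha> * real d)"
      unfolding P_def using \<alpha> dpos by (simp add: field_simps power2_eq_square)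
    ultimately have "P - (s j i)\<^sup>2 = (real d - 1) * (real d + 1 - \<alpha> * z j i) / (\<alpha> * real d)" by simp
    then show ?thesis unfolding c_def using \<alpha> dpos by (simp add: divide_simps mult_ac)
  qed
  have W_prod: "W i = (\<Prod>j<d. (P - (s j i)\<^sup>2) / N)" if "i \<in> I" for i
  proof -
    have "y i = (\<Prod>j<d. c * N * ((P - (s j i)\<^sup>2) / N))"
      unfolding y_def using msg[OF _ that] N_ge dpos by (intro prod.cong) auto
    also have "\<dots> = y0 * (\<Prod>j<d. (P - (s j i)\<^sup>2) / N)" by (simp only: prod.distrib y0_def prod_constant card_lessThan power_mult_distrib)
    finally show ?thesis unfolding W_def using y0 by simp
  qed
  have W_pos: "0 < W i" if "i \<in> I" for i
    unfolding W_prod[OF that] using s_le[OF _ that] qP N_ge dpos by (intro prod_pos divide_pos_pos) fastforce+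
  define k where "k = Y / y0"
  have k_eq: "k = (\<Sum>i\<in>I. W i) / card I" by (simp add: k_def Y_def W_def sum_divide_distrib mult_ac)
  have k_pos: "0 < k" unfolding k_eq using W_pos I q1 by (intro divide_pos_pos sum_pos) (auto simp: q_def card_gt_0_iff)
  have k_ge: "1 - 5 * (1 - A) \<le> k"
  proof -
    have "64 * q \<le> real d" using dq qq by linarith
    then have "1 - 5 * (1 - A) \<le> (\<Sum>i\<in>I. \<Prod>j<d. (P - (s j i)\<^sup>2) / (P - A\<^sup>2)) / card I"
      using I P_ge A01 s_pos s_le s_sq mean d12 by (intro mean_product_ge) (auto simp: q_def A_def s_def)
    also have "\<dots> = k" unfolding k_eq using W_prod by (simp add: N_def)
    finally show ?thesis .
  qed
  define B where "B = A * sqrt \<gamma>"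
  have "B \<le> A" unfolding B_def using A01 \<gamma>01 by (intro mult_left_le) auto
  then have "5 * (1 - A) \<le> 5 * (1 - B)" by simp
  with k_ge have k_le: "1 - k \<le> 5 * (1 - B)" by simp
  have Y_pos: "0 < Y" using k_pos y0 by (simp add: k_def zero_less_divide_iff)
  have yY: "y i / Y = W i / k" for i unfolding W_def k_def using y0 by simp
  have parent_density: "density I (\<lambda>i. y i / Y)"
    unfolding density_def
  proof
    show "\<forall>i\<in>I. 0 \<le> y i / Y" unfolding yY using W_pos k_pos by (auto intro: less_imp_le)
    show "(\<Sum>i\<in>I. y i / Y) = card I"
      unfolding sum_divide_distrib[symmetric] using Y_pos q1 by (simp add: Y_def q_def field_simps)
  qed
  \<comment> \<open>the scale for which a colour of weight \<open>y0\<close> has scaled amplitude \<open>1\<close>\<close>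
  define t where "t = sqrt (real d * k / (real d - 1 + k))"
  have point: "(1 - t * amplitude d (y i / Y))\<^sup>2 \<le> \<gamma> * ((\<Sum>j<d. (s j i - A)\<^sup>2) / d)" if i: "i \<in> I" for i
  proof -
    obtain r where r: "0 < r" "r\<^sup>2 \<le> q" "(P - r\<^sup>2) ^ d = (\<Prod>j<d. P - (s j i)\<^sup>2)"
      "(r - A)\<^sup>2 \<le> (\<Sum>j<d. (s j i - A)\<^sup>2) / d"
      using representative_amplitude[of d A q P "\<lambda>j. s j i"] d12 A01 q1 qP QP s_pos[OF _ i] s_le[OF _ i] by auto
    define x where "x = sqrt \<gamma> * (r - A)"
    have x2: "x\<^sup>2 = \<gamma> * (r - A)\<^sup>2" unfolding x_def using \<gamma>01 by (simp add: power_mult_distrib)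
    have "2 * B * x = \<gamma> * (2 * A * (r - A))"
      unfolding B_def x_def using \<gamma>01 by (simp add: mult_ac)
    then have "2 * B * x + x\<^sup>2 = \<gamma> * (r\<^sup>2 - A\<^sup>2)" unfolding x2 by (simp add: algebra_simps power2_eq_square)
    then have X: "(2 * B * x + x\<^sup>2) / (real d - 1) = (r\<^sup>2 - A\<^sup>2) / N"
      using Nd by (metis mult.commute mult.left_neutral times_divide_eq_right)
    have "W i = ((P - r\<^sup>2) / N) ^ d"
      unfolding W_prod[OF i] prod_dividef power_divide r(3) by simp
    also have "(P - r\<^sup>2) / N = 1 - (r\<^sup>2 - A\<^sup>2) / N" unfolding N_def using N_ge dpos by (simp add: N_def field_simps)
    finally have W_eq: "W i = (1 - (2 * B * x + x\<^sup>2) / (real d - 1)) ^ d" unfolding X .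
    have "t * amplitude d (y i / Y) = sqrt (real d * k / (real d - 1 + k) * (((real d - 1) * (W i / k) + 1) / real d))"
      unfolding t_def amplitude_def yY by (simp only: real_sqrt_mult)
    also have "real d * k / (real d - 1 + k) * (((real d - 1) * (W i / k) + 1) / real d) = ((real d - 1) * W i + k) / (real d - 1 + k)"
      using k_pos dpos by (simp add: divide_simps)
    finally have ts: "t * amplitude d (y i / Y) = sqrt (((real d - 1) * W i + k) / (real d - 1 + k))" .
    have "(1 - t * amplitude d (y i / Y))\<^sup>2 \<le> x\<^sup>2"
      unfolding ts W_eq
    proof (rule reflected_amplitude[OF d12])
      show "0 \<le> B" "B \<le> 1" using A01 \<gamma>01 by (auto simp: B_def intro: mult_le_one)
      show "- B \<le> x" using r(1) \<gamma>01 by (simp add: B_def x_def algebra_simps)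
      show "0 < k" "1 - k \<le> 5 * (1 - B)" using k_pos k_le by auto
      show "(2 * B * x + x\<^sup>2) / (real d - 1) \<le> 1"
        unfolding X using r(2) qP N_ge dpos by (simp add: N_def)
    qed
    also have "\<dots> \<le> \<gamma> * ((\<Sum>j<d. (s j i - A)\<^sup>2) / d)"
      unfolding x2 using r(4) \<gamma>01 by (intro mult_left_mono) auto
    finally show ?thesis .
  qed
  have "(\<Sum>i\<in>I. (1 - t * amplitude d (y i / Y))\<^sup>2) \<le> (\<Sum>i\<in>I. \<gamma> * ((\<Sum>j<d. (s j i - A)\<^sup>2) / d))"
    using point by (rule sum_mono)
  also have "\<dots> = \<gamma> * ((\<Sum>i\<in>I. \<Sum>j<d. (s j i - A)\<^sup>2) / d)"
    by (simp add: sum_distrib_left sum_divide_distrib)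
  also have "(\<Sum>i\<in>I. \<Sum>j<d. (s j i - A)\<^sup>2) = (\<Sum>j<d. \<Sum>i\<in>I. (s j i - A)\<^sup>2)" by (rule sum.swap)
  also have "\<gamma> * ((\<Sum>j<d. \<Sum>i\<in>I. (s j i - A)\<^sup>2) / d) \<le> \<gamma> * ((\<Sum>j<d. q * V) / d)"
  proof (intro mult_left_mono divide_right_mono sum_mono)
    fix j assume "j \<in> {..<d}"
    then have j: "j < d" by simp
    have "2 * A * (q * A) \<le> 2 * A * (\<Sum>i\<in>I. s j i)"
      using mean[OF j] A01 by (intro mult_left_mono) (auto simp: q_def A_def s_def)
    then have "(\<Sum>i\<in>I. (s j i - A)\<^sup>2) \<le> q * (1 + A\<^sup>2) - 2 * A * (q * A)"
      unfolding sum_deviation[OF s_sq[OF j]] by (simp add: q_def)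
    also have "\<dots> = q * (1 - A\<^sup>2)" by algebra
    finally show "(\<Sum>i\<in>I. (s j i - A)\<^sup>2) \<le> q * V" using A2 by simp
  qed (use \<gamma>01 in auto)
  also have "\<dots> = card I * (\<gamma> * V)" using dpos by (simp add: q_def)
  finally have dev: "(\<Sum>i\<in>I. (1 - t * amplitude d (y i / Y))\<^sup>2) \<le> card I * (\<gamma> * V)" .
  show "card I * sqrt (1 - \<gamma> * V) \<le> (\<Sum>i\<in>I. amplitude d (y i / Y))"
  proof (rule sum_ge_of_scaled_deviation[OF I _ _ dev])
    show "0 \<le> amplitude d (y i / Y)" if "i \<in> I" for i
      by (rule less_imp_le, rule amplitude_pos) (use parent_density that d12 in \<open>auto simp: density_def\<close>)
    show "(\<Sum>i\<in>I. (amplitude d (y i / Y))\<^sup>2) = card I"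
      using parent_density d12 by (intro sum_amplitude_square) auto
  qed
qed

section \<open>Partition functions of the truncated tree\<close>

text \<open>The vertices of the truncated tree, and its leaves, in the coordinates provided by \<open>trunc_tree_eq\<close> and
\<open>leaves_eq\<close>; unlike these they also make sense at depth \<open>0\<close>, where the recursion starts.\<close>

definition words :: "nat \<Rightarrow> nat \<Rightarrow> nat list set" where
  "words d n = {xs. set xs \<subseteq> {..<d} \<and> length xs \<le> n}"

definition top_words :: "nat \<Rightarrow> nat \<Rightarrow> nat list set" where
  "top_words d n = {xs. set xs \<subseteq> {..<d} \<and> length xs = n}"

lemma finite_words [simp]: "finite (words d n)"
  unfolding words_def by (rule finite_lists_length_le) simp

lemma top_words_subset: "top_words d n \<subseteq> words d n"
  by (auto simp: words_def top_words_def)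

lemma finite_top_words [simp]: "finite (top_words d n)"
  using finite_subset[OF top_words_subset finite_words] .

lemma Nil_in_words [simp]: "[] \<in> words d n"
  by (simp add: words_def)

lemma Cons_in_words [simp]: "j # ys \<in> words d (Suc n) \<longleftrightarrow> j < d \<and> ys \<in> words d n"
  by (auto simp: words_def)

lemma Cons_in_top_words [simp]: "j # ys \<in> top_words d (Suc n) \<longleftrightarrow> j < d \<and> ys \<in> top_words d n"
  by (auto simp: top_words_def)

lemma Nil_not_in_top_words [simp]: "[] \<notin> top_words d (Suc n)"
  by (simp add: top_words_def)

lemma butlast_in_words: "xs \<in> words d n \<Longrightarrow> butlast xs \<in> words d n"
  by (auto simp: words_def dest: in_set_butlastD)

definition weight :: "nat \<Rightarrow> real \<Rightarrow> nat \<Rightarrow> (nat list \<Rightarrow> nat) \<Rightarrow> real" where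
  "weight d w n \<sigma> = (\<Prod>ys\<in>words d n - {[]}. if \<sigma> (butlast ys) = \<sigma> ys then w else 1)"

text \<open>Every edge is identified with its lower end, a nonempty word.\<close>

lemma power_mono_edges:
  "w ^ mono_edges (word_graph (words d n)) \<sigma> = weight d w n \<sigma>"
proof -
  let ?M = "{ys \<in> words d n - {[]}. \<sigma> (butlast ys) = \<sigma> ys}"
  let ?f = "\<lambda>ys. {butlast ys, ys}"
  have inj: "inj_on ?f ?M"
  proof (rule inj_onI)
    fix xs ys assume "xs \<in> ?M" "ys \<in> ?M" and eq: "{butlast xs, xs} = {butlast ys, ys}"
    then have ne: "xs \<noteq> []" "ys \<noteq> []" by auto
    show "xs = ys"
    proof (rule ccontr)
      assume "xs \<noteq> ys"
      with eq have "butlast xs = ys" "xs = butlast ys" by (auto simp: doubleton_eq_iff)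
      then have "length xs = length (butlast (butlast xs))" by simp
      moreover have "0 < length xs" using ne by simp
      ultimately show False unfolding length_butlast by linarith
    qed
  qed
  have img: "{e \<in> edges (word_graph (words d n)). \<exists>u v. e = {u, v} \<and> \<sigma> u = \<sigma> v} = ?f ` ?M" (is "?E = _")
  proof
    show "?f ` ?M \<subseteq> ?E"
    proof
      fix e assume "e \<in> ?f ` ?M"
      then obtain ys where ys: "ys \<in> words d n" "ys \<noteq> []" "\<sigma> (butlast ys) = \<sigma> ys" "e = {butlast ys, ys}" by auto
      then have "e = {butlast ys, butlast ys @ [last ys]}" "butlast ys @ [last ys] \<in> words d n" by auto
      then show "e \<in> ?E" using ys(3,4) unfolding word_graph_def by auto
    qed
    show "?E \<subseteq> ?f ` ?M"
    proof
      fix e assume "e \<in> ?E"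
      then have "e \<in> edges (word_graph (words d n))" "\<exists>u v. e = {u, v} \<and> \<sigma> u = \<sigma> v" by simp_all
      then obtain xs a u v where e: "e = {xs, xs @ [a]}" "xs @ [a] \<in> words d n" "e = {u, v}" "\<sigma> u = \<sigma> v"
        unfolding word_graph_def ugraph.select_convs mem_Collect_eq by blast
      then have "{xs, xs @ [a]} = {u, v}" by metis
      then have "\<sigma> xs = \<sigma> (xs @ [a])" using e(4) unfolding doubleton_eq_iff by metis
      then have "xs @ [a] \<in> ?M" using e(2) by simp
      moreover have "e = ?f (xs @ [a])" using e(1) by simp
      ultimately show "e \<in> ?f ` ?M" by (rule rev_image_eqI)
    qed
  qed
  have "mono_edges (word_graph (words d n)) \<sigma> = card ?M"
    unfolding mono_edges_def img by (rule card_image[OF inj])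
  then have "w ^ mono_edges (word_graph (words d n)) \<sigma> = (\<Prod>ys\<in>?M. w)" by simp
  also have "\<dots> = weight d w n \<sigma>" unfolding weight_def by (rule prod.inter_filter) simp
  finally show ?thesis .
qed

lemma weight_cong:
  assumes "\<And>ys. ys \<in> words d n \<Longrightarrow> \<sigma> ys = \<sigma>' ys"
  shows "weight d w n \<sigma> = weight d w n \<sigma>'"
  unfolding weight_def using assms butlast_in_words by (intro prod.cong) auto

lemma weight_pos: "w > 0 \<Longrightarrow> weight d w n \<sigma> > 0"
  unfolding weight_def by (intro prod_pos) auto

text \<open>The nonempty words are grouped by their first letter, that is, by the child of the root below which they lie.\<close>

lemma weight_Suc:
  "weight d w (Suc n) \<sigma> =
    (\<Prod>j<d. (if \<sigma> [] = \<sigma> [j] then w else 1) * weight d w n (\<lambda>ys. \<sigma> (j # ys)))"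
proof -
  let ?t = "\<lambda>ys. if \<sigma> (butlast ys) = \<sigma> ys then w else 1"
  have "words d (Suc n) - {[]} = (\<lambda>(j, ys). j # ys) ` ({..<d} \<times> words d n)"
  proof (intro set_eqI iffI)
    fix xs assume "xs \<in> words d (Suc n) - {[]}"
    then show "xs \<in> (\<lambda>(j, ys). j # ys) ` ({..<d} \<times> words d n)"
      by (cases xs) auto
  qed auto
  then have "weight d w (Suc n) \<sigma> = (\<Prod>x\<in>{..<d} \<times> words d n. ?t (case x of (j, ys) \<Rightarrow> j # ys))"
    unfolding weight_def by (simp add: prod.reindex inj_on_def o_def)
  also have "\<dots> = (\<Prod>j<d. \<Prod>ys\<in>words d n. ?t (j # ys))"
    by (simp add: prod.cartesian_product case_prod_unfold)
  also have "\<dots> = (\<Prod>j<d. ?t [j] * (\<Prod>ys\<in>words d n - {[]}. ?t (j # ys)))"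
    by (intro prod.cong refl prod.remove) auto
  also have "\<dots> = (\<Prod>j<d. (if \<sigma> [] = \<sigma> [j] then w else 1) * weight d w n (\<lambda>ys. \<sigma> (j # ys)))"
    unfolding weight_def by (intro prod.cong refl arg_cong2[where f="(*)"]) auto
  finally show ?thesis .
qed

definition extensions :: "nat \<Rightarrow> nat \<Rightarrow> nat \<Rightarrow> (nat list \<Rightarrow> nat) \<Rightarrow> (nat list \<Rightarrow> nat) set" where
  "extensions d q n \<tau> = {\<sigma> \<in> colourings (words d n) q. restrict \<sigma> (top_words d n) = \<tau>}"

definition root_weight :: "nat \<Rightarrow> nat \<Rightarrow> real \<Rightarrow> nat \<Rightarrow> (nat list \<Rightarrow> nat) \<Rightarrow> nat \<Rightarrow> real" where
  "root_weight d q w n \<tau> i = (\<Sum>\<sigma>\<in>{\<sigma> \<in> extensions d q n \<tau>. \<sigma> [] = i}. weight d w n \<sigma>)"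

definition subtree_boundary :: "nat \<Rightarrow> nat \<Rightarrow> (nat list \<Rightarrow> nat) \<Rightarrow> nat \<Rightarrow> nat list \<Rightarrow> nat" where
  "subtree_boundary d n \<tau> j = restrict (\<lambda>ys. \<tau> (j # ys)) (top_words d n)"

lemma finite_colourings_words [simp]: "finite (colourings (words d n) q)"
  unfolding colourings_def by (intro finite_PiE) auto

lemma finite_extensions [simp]: "finite (extensions d q n \<tau>)"
  unfolding extensions_def by simp

lemma sum_extensions_by_root:
  "(\<Sum>\<sigma>\<in>extensions d q n \<tau>. h (\<sigma> []) * weight d w n \<sigma>) = (\<Sum>k=1..q. h k * root_weight d q w n \<tau> k)"
proof -
  have "(\<lambda>\<sigma>. \<sigma> []) ` extensions d q n \<tau> \<subseteq> {1..q}"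
    unfolding extensions_def colourings_def using Nil_in_words by (force simp: PiE_iff)
  then have "(\<Sum>\<sigma>\<in>extensions d q n \<tau>. h (\<sigma> []) * weight d w n \<sigma>)
      = (\<Sum>k=1..q. \<Sum>\<sigma>\<in>{\<sigma> \<in> extensions d q n \<tau>. \<sigma> [] = k}. h (\<sigma> []) * weight d w n \<sigma>)"
    by (intro sum.group[symmetric]) auto
  also have "\<dots> = (\<Sum>k=1..q. h k * root_weight d q w n \<tau> k)"
    unfolding root_weight_def sum_distrib_left by (intro sum.cong) auto
  finally show ?thesis .
qed

text \<open>A colouring with root colour \<open>i\<close> is the same as a choice of one colouring for each of the \<open>d\<close> subtrees,
and both the weight and the boundary condition factorise accordingly.\<close>

lemma root_weight_Suc:
  assumes \<tau>: "\<tau> \<in> colourings (top_words d (Suc n)) q" and i: "i \<in> {1..q}"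
  shows "root_weight d q w (Suc n) \<tau> i =
    (\<Prod>j<d. \<Sum>k=1..q. (if i = k then w else 1) * root_weight d q w n (subtree_boundary d n \<tau> j) k)"
proof -
  let ?K = "\<lambda>j. extensions d q n (subtree_boundary d n \<tau> j)"
  let ?S = "{\<sigma> \<in> extensions d q (Suc n) \<tau>. \<sigma> [] = i}"
  let ?split = "\<lambda>\<sigma>. \<lambda>j\<in>{..<d}. \<lambda>ys\<in>words d n. \<sigma> (j # ys)"
  let ?join = "\<lambda>g. \<lambda>xs\<in>words d (Suc n). case xs of [] \<Rightarrow> i | j # ys \<Rightarrow> g j ys"
  let ?h = "\<lambda>j \<sigma>. (if i = \<sigma> [] then w else 1) * weight d w n \<sigma>"
  have "root_weight d q w (Suc n) \<tau> i = (\<Sum>g\<in>PiE {..<d} ?K. \<Prod>j<d. ?h j (g j))"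
    unfolding root_weight_def
  proof (rule sum.reindex_bij_witness[of _ ?join ?split])
    fix \<sigma> assume "\<sigma> \<in> ?S"
    then have \<sigma>: "\<sigma> \<in> words d (Suc n) \<rightarrow>\<^sub>E {1..q}" "restrict \<sigma> (top_words d (Suc n)) = \<tau>" "\<sigma> [] = i"
      by (auto simp: extensions_def colourings_def)
    show "?join (?split \<sigma>) = \<sigma>"
    proof
      fix xs show "?join (?split \<sigma>) xs = \<sigma> xs"
        using \<sigma>(1,3) by (cases xs) (auto simp: PiE_iff extensional_def)
    qed
    show "?split \<sigma> \<in> PiE {..<d} ?K"
    proof (intro PiE_I)
      fix j assume j: "j \<in> {..<d}"
      have "restrict (\<lambda>ys\<in>words d n. \<sigma> (j # ys)) (top_words d n) = subtree_boundary d n \<tau> j"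
        unfolding subtree_boundary_def \<sigma>(2)[symmetric] using j top_words_subset[of d n]
        by (intro ext) (auto simp: restrict_def)
      moreover have "(\<lambda>ys\<in>words d n. \<sigma> (j # ys)) \<in> words d n \<rightarrow>\<^sub>E {1..q}"
        using \<sigma>(1) j by (intro restrict_PiE_iff[THEN iffD2] ballI) (auto simp: PiE_iff)
      ultimately show "?split \<sigma> j \<in> ?K j" using j by (simp add: extensions_def colourings_def)
    qed simp
    show "(\<Prod>j<d. ?h j (?split \<sigma> j)) = weight d w (Suc n) \<sigma>"
      unfolding weight_Suc \<sigma>(3)
      by (intro prod.cong refl arg_cong2[where f="(*)"] weight_cong) auto
  next
    fix g assume g: "g \<in> PiE {..<d} ?K"
    have gj: "g j \<in> words d n \<rightarrow>\<^sub>E {1..q}" "restrict (g j) (top_words d n) = subtree_boundary d n \<tau> j" if "j < d" for j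
      using PiE_mem[OF g, of j] that by (auto simp: extensions_def colourings_def)
    show "?split (?join g) = g"
    proof (intro ext)
      fix j ys show "?split (?join g) j ys = g j ys"
      proof (cases "j < d")
        case True
        then show ?thesis using gj(1)[OF True] by (auto simp: PiE_iff extensional_def)
      next
        case False
        then show ?thesis using g by (auto simp: PiE_iff extensional_def)
      qed
    qed
    have "?join g \<in> words d (Suc n) \<rightarrow>\<^sub>E {1..q}"
    proof (intro restrict_PiE_iff[THEN iffD2] ballI)
      fix xs assume "xs \<in> words d (Suc n)"
      then show "(case xs of [] \<Rightarrow> i | j # ys \<Rightarrow> g j ys) \<in> {1..q}"
        using i gj(1) by (cases xs) (auto simp: PiE_iff)
    qed
    moreover have "restrict (?join g) (top_words d (Suc n)) = \<tau>"
    proof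
      fix xs show "restrict (?join g) (top_words d (Suc n)) xs = \<tau> xs"
      proof (cases xs)
        case Nil
        then show ?thesis using \<tau> by (auto simp: colourings_def PiE_iff extensional_def)
      next
        case (Cons j ys)
        show ?thesis
        proof (cases "j < d \<and> ys \<in> top_words d n")
          case True
          then have "g j ys = \<tau> (j # ys)"
            using fun_cong[OF gj(2)[of j], of ys] by (simp add: subtree_boundary_def)
          then show ?thesis using True Cons top_words_subset[of d n] by auto
        next
          case False
          then show ?thesis using \<tau> Cons by (auto simp: colourings_def PiE_iff extensional_def)
        qed
      qed
    qed
    ultimately show "?join g \<in> ?S" by (simp add: extensions_def colourings_def)
  qed
  also have "\<dots> = (\<Prod>j<d. \<Sum>\<sigma>\<in>?K j. ?h j \<sigma>)"
    by (rule prod_sum_PiE[symmetric]) auto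
  also have "\<dots> = (\<Prod>j<d. \<Sum>k=1..q. (if i = k then w else 1) * root_weight d q w n (subtree_boundary d n \<tau> j) k)"
    by (intro prod.cong refl sum_extensions_by_root)
  finally show ?thesis .
qed

text \<open>The partition function of the unconditioned measure cancels.\<close>

lemma root_prob_eq:
  assumes n: "n \<ge> 1" and q: "q \<ge> 1" and w: "w > 0"
  shows "root_prob d q w n \<tau> i = root_weight d q w n \<tau> i / (\<Sum>k=1..q. root_weight d q w n \<tau> k)"
proof -
  define G where "G = trunc_tree d n"
  have G: "G = word_graph (words d n)" unfolding G_def trunc_tree_eq[OF n] words_def ..
  have L: "leaves d n = top_words d n" unfolding leaves_eq[OF n] top_words_def ..
  have V: "verts G = words d n" by (simp add: G)
  define \<Omega> where "\<Omega> = colourings (words d n) q"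
  define Z where "Z = (\<Sum>\<sigma>\<in>\<Omega>. weight d w n \<sigma>)"
  have p: "potts_prob G q w \<phi> = weight d w n \<phi> / Z" for \<phi>
    unfolding potts_prob_def V Z_def \<Omega>_def unfolding G power_mono_edges ..
  have "\<Omega> \<noteq> {}" using q by (auto simp: \<Omega>_def colourings_def PiE_eq_empty_iff)
  then have Z: "Z > 0" unfolding Z_def using weight_pos[OF w] by (intro sum_pos) (auto simp: \<Omega>_def)
  have meas: "measure (potts_measure G q w) {\<phi> \<in> space (potts_measure G q w). R \<phi>}
      = (\<Sum>\<phi>\<in>{\<phi> \<in> \<Omega>. R \<phi>}. weight d w n \<phi>) / Z" for R
  proof -
    have "emeasure (potts_measure G q w) {\<phi> \<in> \<Omega>. R \<phi>} = (\<Sum>\<phi>\<in>{\<phi> \<in> \<Omega>. R \<phi>}. ennreal (weight d w n \<phi> / Z))"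
      unfolding potts_measure_def V p \<Omega>_def by (intro emeasure_point_measure_finite) auto
    also have "\<dots> = ennreal ((\<Sum>\<phi>\<in>{\<phi> \<in> \<Omega>. R \<phi>}. weight d w n \<phi>) / Z)"
      using weight_pos[OF w] Z by (simp add: sum_divide_distrib sum_ennreal less_imp_le)
    finally show ?thesis
      using weight_pos[OF w] Z
      by (simp add: measure_def potts_measure_def V space_point_measure \<Omega>_def sum_nonneg less_imp_le)
  qed
  have "root_prob d q w n \<tau> i =
      ((\<Sum>\<phi>\<in>{\<phi> \<in> \<Omega>. \<phi> [] = i \<and> restrict \<phi> (top_words d n) = \<tau>}. weight d w n \<phi>) / Z) /
      ((\<Sum>\<phi>\<in>{\<phi> \<in> \<Omega>. restrict \<phi> (top_words d n) = \<tau>}. weight d w n \<phi>) / Z)"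
    unfolding root_prob_def cond_prob_def G_def[symmetric] L meas ..
  also have "{\<phi> \<in> \<Omega>. \<phi> [] = i \<and> restrict \<phi> (top_words d n) = \<tau>} = {\<sigma> \<in> extensions d q n \<tau>. \<sigma> [] = i}"
    by (auto simp: \<Omega>_def extensions_def)
  also have "{\<phi> \<in> \<Omega>. restrict \<phi> (top_words d n) = \<tau>} = extensions d q n \<tau>"
    by (auto simp: \<Omega>_def extensions_def)
  also have "(\<Sum>\<sigma>\<in>extensions d q n \<tau>. weight d w n \<sigma>) = (\<Sum>k=1..q. root_weight d q w n \<tau> k)"
    using sum_extensions_by_root[of "\<lambda>_. 1"] by simp
  finally show ?thesis using Z by (simp add: root_weight_def)
qed

section \<open>The marginal at the root\<close>

lemma root_weight_sum_pos:
  assumes "\<tau> \<in> colourings (top_words d n) q" "q \<ge> 1" "w > 0"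
  shows "0 < (\<Sum>k=1..q. root_weight d q w n \<tau> k)"
proof -
  let ?\<sigma> = "\<lambda>xs\<in>words d n. if xs \<in> top_words d n then \<tau> xs else 1"
  have "?\<sigma> \<in> words d n \<rightarrow>\<^sub>E {1..q}"
    using assms by (intro restrict_PiE_iff[THEN iffD2] ballI) (auto simp: colourings_def PiE_iff)
  moreover have "restrict ?\<sigma> (top_words d n) = \<tau>"
    using assms(1) top_words_subset[of d n]
    by (intro ext) (auto simp: colourings_def PiE_iff extensional_def restrict_def)
  ultimately have "extensions d q n \<tau> \<noteq> {}" unfolding extensions_def colourings_def by blast
  then have "0 < (\<Sum>\<sigma>\<in>extensions d q n \<tau>. weight d w n \<sigma>)"
    using weight_pos[OF assms(3)] by (intro sum_pos) auto
  then show ?thesis using sum_extensions_by_root[of "\<lambda>_. 1"] by simp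
qed

definition root_density :: "nat \<Rightarrow> nat \<Rightarrow> real \<Rightarrow> nat \<Rightarrow> (nat list \<Rightarrow> nat) \<Rightarrow> nat \<Rightarrow> real" where
  "root_density d q w n \<tau> i =
     real q * root_weight d q w n \<tau> i / (\<Sum>k=1..q. root_weight d q w n \<tau> k)"

lemma density_root_density:
  assumes "\<tau> \<in> colourings (top_words d n) q" "q \<ge> 1" "w > 0"
  shows "density {1..q} (root_density d q w n \<tau>)"
  unfolding density_def
proof
  have "0 \<le> root_weight d q w n \<tau> i" for i
    unfolding root_weight_def using weight_pos[OF assms(3)] by (intro sum_nonneg less_imp_le)
  then show "\<forall>i\<in>{1..q}. 0 \<le> root_density d q w n \<tau> i"
    unfolding root_density_def by (auto intro!: divide_nonneg_nonneg mult_nonneg_nonneg sum_nonneg)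
  show "(\<Sum>i=1..q. root_density d q w n \<tau> i) = card {1..q}"
    unfolding root_density_def using root_weight_sum_pos[OF assms]
    by (simp add: sum_divide_distrib[symmetric] sum_distrib_left[symmetric])
qed

lemma subtree_boundary_colouring:
  assumes "\<tau> \<in> colourings (top_words d (Suc n)) q" "j < d"
  shows "subtree_boundary d n \<tau> j \<in> colourings (top_words d n) q"
  unfolding colourings_def subtree_boundary_def
  using assms by (intro restrict_PiE_iff[THEN iffD2] ballI) (auto simp: colourings_def PiE_iff)

text \<open>The belief propagation recursion: a child with conditional law \<open>x\<close> multiplies the weight of colour \<open>i\<close> by
\<open>1 - (1 - w) x i\<close>, and \<open>(1 - w) x i = \<alpha> z i / (d + 1)\<close> for its density \<open>z = q x\<close>.\<close>

lemma root_density_Suc: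
  fixes \<alpha> :: real
  assumes \<tau>: "\<tau> \<in> colourings (top_words d (Suc n)) q" and q: "q \<ge> 1"
    and w: "w = 1 - \<alpha> * real q / real (d + 1)" "w > 0" and i: "i \<in> {1..q}"
  defines "y \<equiv> \<lambda>i. \<Prod>j<d. 1 - \<alpha> * root_density d q w n (subtree_boundary d n \<tau> j) i / (real d + 1)"
  shows "root_density d q w (Suc n) \<tau> i = y i / ((\<Sum>i\<in>{1..q}. y i) / card {1..q})"
proof -
  define T where "T j = (\<Sum>k=1..q. root_weight d q w n (subtree_boundary d n \<tau> j) k)" for j
  have T: "0 < T j" if "j < d" for j
    unfolding T_def using root_weight_sum_pos[OF subtree_boundary_colouring[OF \<tau> that] q w(2)] .
  have rw: "root_weight d q w (Suc n) \<tau> i = (\<Prod>j<d. T j) * y i" if i: "i \<in> {1..q}" for i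
  proof -
    have "(\<Sum>k=1..q. (if i = k then w else 1) * root_weight d q w n (subtree_boundary d n \<tau> j) k)
        = T j * (1 - \<alpha> * root_density d q w n (subtree_boundary d n \<tau> j) i / (real d + 1))" if j: "j < d" for j
    proof -
      let ?r = "root_weight d q w n (subtree_boundary d n \<tau> j)"
      have "(\<Sum>k=1..q. (if i = k then w else 1) * ?r k) = (\<Sum>k=1..q. ?r k + (if i = k then (w - 1) * ?r i else 0))"
        by (intro sum.cong) (auto simp: algebra_simps)
      also have "\<dots> = T j + (w - 1) * ?r i" using i by (simp add: sum.distrib T_def)
      also have "\<dots> = T j * (1 - \<alpha> * root_density d q w n (subtree_boundary d n \<tau> j) i / (real d + 1))"
      proof -
        have "root_density d q w n (subtree_boundary d n \<tau> j) i = real q * ?r i / T j"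
          unfolding root_density_def T_def ..
        moreover have "w - 1 = - (\<alpha> * real q / (real d + 1))" unfolding w(1) by simp
        ultimately show ?thesis using T[OF j] by (simp add: right_diff_distrib)
      qed
      finally show ?thesis .
    qed
    then have "root_weight d q w (Suc n) \<tau> i
        = (\<Prod>j<d. T j * (1 - \<alpha> * root_density d q w n (subtree_boundary d n \<tau> j) i / (real d + 1)))"
      unfolding root_weight_Suc[OF \<tau> i] by (intro prod.cong) auto
    then show ?thesis by (simp add: prod.distrib y_def)
  qed
  define R where "R = (\<Prod>j<d. T j)"
  have "0 < R" unfolding R_def using T by (intro prod_pos) auto
  moreover have "(\<Sum>k=1..q. root_weight d q w (Suc n) \<tau> k) = R * (\<Sum>k=1..q. y k)"
    using rw by (simp add: sum_distrib_left R_def)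
  ultimately show ?thesis unfolding root_density_def using rw[OF i] by (simp add: R_def[symmetric])
qed

text \<open>The start of the recursion, where the boundary fixes the colour. The amplitude is at most the square root of
\<open>card I\<close>, so its mean is at least its mean square divided by that root.\<close>

lemma sum_amplitude_ge:
  assumes I: "finite I" "I \<noteq> {}" and z: "density I z" and d: "d \<ge> 1"
  shows "card I * sqrt (1 / card I) \<le> (\<Sum>i\<in>I. amplitude d (z i))"
proof -
  define q where "q = real (card I)"
  have q: "0 < q" using I by (simp add: q_def card_gt_0_iff)
  have "(amplitude d (z i))\<^sup>2 / sqrt q \<le> amplitude d (z i)" if i: "i \<in> I" for i
  proof -
    have pos: "0 < amplitude d (z i)" using z i d by (intro amplitude_pos) (auto simp: density_def)
    have "amplitude d (z i) \<le> sqrt q"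
      using amplitude_square_le[OF I(1) z i d] pos unfolding q_def by (intro real_le_rsqrt)
    then have "amplitude d (z i) * amplitude d (z i) \<le> amplitude d (z i) * sqrt q"
      using pos by (intro mult_left_mono) auto
    then show ?thesis using q by (simp add: power2_eq_square pos_divide_le_eq)
  qed
  then have "(\<Sum>i\<in>I. (amplitude d (z i))\<^sup>2 / sqrt q) \<le> (\<Sum>i\<in>I. amplitude d (z i))" by (rule sum_mono)
  also have "(\<Sum>i\<in>I. (amplitude d (z i))\<^sup>2 / sqrt q) = q * sqrt (1 / q)"
    unfolding sum_divide_distrib[symmetric] sum_amplitude_square[OF z d] using q by (simp add: q_def real_sqrt_divide)
  finally show ?thesis by (simp add: q_def)
qed

text \<open>The mean square distance of the amplitude from \<open>1\<close> is \<open>2 - 2 E s \<le> 2 V\<close>, and \<open>z - 1\<close> is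
proportional to \<open>s\<^sup>2 - 1\<close>.\<close>

lemma density_near_one:
  assumes I: "finite I" "i \<in> I" and z: "density I z" and d: "d \<ge> 2" and V: "0 \<le> V" "V \<le> 1"
    and mean: "card I * sqrt (1 - V) \<le> (\<Sum>i\<in>I. amplitude d (z i))"
  shows "\<bar>z i - 1\<bar> \<le> 6 * card I * sqrt V"
proof -
  define q where "q = real (card I)"
  define s where "s i = amplitude d (z i)" for i
  have q1: "1 \<le> q" using I unfolding q_def
    by (metis One_nat_def Suc_leI card_gt_0_iff empty_iff of_nat_1 of_nat_le_iff)
  have "(s i - 1)\<^sup>2 \<le> (\<Sum>i\<in>I. (s i - 1)\<^sup>2)" using I by (intro member_le_sum) auto
  also have "\<dots> = 2 * q - 2 * (\<Sum>i\<in>I. s i)"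
    using sum_deviation[of s I 1] sum_amplitude_square[OF z, of d] d by (simp add: q_def s_def)
  also have "\<dots> \<le> 2 * q - 2 * (q * sqrt (1 - V))" using mean by (simp add: q_def s_def)
  also have "\<dots> \<le> 2 * q * V"
  proof -
    have "(1 - V) * (1 - V) \<le> (1 - V) * 1" using V by (intro mult_left_mono) auto
    then have "1 - V \<le> sqrt (1 - V)" using V by (intro real_le_rsqrt) (simp add: power2_eq_square)
    then have "q * (1 - V) \<le> q * sqrt (1 - V)" using q1 by (intro mult_left_mono) auto
    then show ?thesis by (simp add: algebra_simps)
  qed
  finally have dev: "(s i - 1)\<^sup>2 \<le> 2 * q * V" .
  have s2: "(s i)\<^sup>2 = ((real d - 1) * z i + 1) / real d"
    unfolding s_def using z I d by (intro amplitude_square) (auto simp: density_def)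
  have "(s i + 1)\<^sup>2 = 2 * (s i)\<^sup>2 + 2 - (s i - 1)\<^sup>2" by algebra
  also have "\<dots> \<le> 4 * q"
    using amplitude_square_le[OF I(1) z I(2), of d] d q1 zero_le_power2[of "s i - 1"] unfolding s_def q_def by linarith
  finally have sum: "(s i + 1)\<^sup>2 \<le> 4 * q" .
  have "z i - 1 = real d / (real d - 1) * ((s i)\<^sup>2 - 1)"
    unfolding s2 using d by (simp add: field_simps)
  also have "(s i)\<^sup>2 - 1 = (s i + 1) * (s i - 1)" by algebra
  finally have "(z i - 1)\<^sup>2 = (real d / (real d - 1))\<^sup>2 * ((s i + 1)\<^sup>2 * (s i - 1)\<^sup>2)"
    by (simp only: power_mult_distrib)
  also have "\<dots> \<le> 2\<^sup>2 * (4 * q * (2 * q * V))"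
    using d sum dev q1 by (intro mult_mono power_mono) (auto simp: divide_simps)
  also have "\<dots> = 32 * q\<^sup>2 * V" by (simp add: power2_eq_square)
  also have "\<dots> \<le> 36 * q\<^sup>2 * V" using V by (intro mult_right_mono) auto
  also have "\<dots> = (6 * q * sqrt V)\<^sup>2" using V by (simp add: power_mult_distrib)
  finally have "\<bar>z i - 1\<bar> \<le> \<bar>6 * q * sqrt V\<bar>" by (simp only: abs_le_square_iff)
  then show ?thesis using q1 V by (simp add: q_def)
qed

text \<open>Here \<open>V\<close> is any sequence that dominates the recursion of \<open>contraction_step\<close> and starts at the trivial bound.\<close>

lemma amplitude_root_density_ge:
  fixes V :: "nat \<Rightarrow> real" and \<alpha> :: real
  assumes q: "q \<ge> 2" and d: "d \<ge> 12000 * q\<^sup>2" and \<alpha>: "0 < \<alpha>" "\<alpha> \<le> 1"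
    and w: "w = 1 - \<alpha> * real q / real (d + 1)"
    and V0: "V 0 = 1 - 1 / q" and V: "\<And>n. 0 \<le> V n" "\<And>n. V n \<le> 1 - 1 / q"
    and step: "\<And>n. (real d - 1) / (((real d)\<^sup>2 - 1 + \<alpha>) / (\<alpha> * real d) - (1 - V n)) * V n \<le> V (Suc n)"
    and \<tau>: "\<tau> \<in> colourings (top_words d n) q"
  shows "w > 0" and "q * sqrt (1 - V n) \<le> (\<Sum>i=1..q. amplitude d (root_density d q w n \<tau> i))"
proof -
  have "q \<le> q\<^sup>2" by (simp add: power2_eq_square)
  then have qd: "q \<le> d" and d1: "d \<ge> 1" using d q by linarith+
  have "\<alpha> * real q \<le> 1 * real q" using \<alpha> by (intro mult_right_mono) auto
  then have "\<alpha> * real q < real (d + 1)" using qd by simp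
  then show w0: "w > 0" unfolding w by simp
  show "q * sqrt (1 - V n) \<le> (\<Sum>i=1..q. amplitude d (root_density d q w n \<tau> i))"
    using \<tau>
  proof (induction n arbitrary: \<tau>)
    case 0
    then show ?case
      using sum_amplitude_ge[OF _ _ density_root_density[OF 0 _ w0] d1] q V0 by simp
  next
    case (Suc n)
    let ?z = "\<lambda>j. root_density d q w n (subtree_boundary d n \<tau> j)"
    let ?y = "\<lambda>i. \<Prod>j<d. 1 - \<alpha> * ?z j i / (real d + 1)"
    let ?\<gamma> = "(real d - 1) / (((real d)\<^sup>2 - 1 + \<alpha>) / (\<alpha> * real d) - (1 - V n))"
    have "q * sqrt (1 - V (Suc n)) \<le> q * sqrt (1 - ?\<gamma> * V n)"
      using step[of n] by (intro mult_left_mono) auto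
    also have "card {1..q} * sqrt (1 - ?\<gamma> * V n)
        \<le> (\<Sum>i\<in>{1..q}. amplitude d (?y i / ((\<Sum>i\<in>{1..q}. ?y i) / card {1..q})))"
    proof (rule contraction_step)
      fix j assume j: "j < d"
      note \<tau>j = subtree_boundary_colouring[OF Suc.prems j]
      show "density {1..q} (?z j)" using density_root_density[OF \<tau>j _ w0] q by simp
      show "card {1..q} * sqrt (1 - V n) \<le> (\<Sum>i\<in>{1..q}. amplitude d (?z j i))" using Suc.IH[OF \<tau>j] by simp
    qed (use q d \<alpha> V in auto)
    then have "q * sqrt (1 - ?\<gamma> * V n)
        \<le> (\<Sum>i\<in>{1..q}. amplitude d (?y i / ((\<Sum>i\<in>{1..q}. ?y i) / card {1..q})))" by simp
    also have "\<dots> = (\<Sum>i=1..q. amplitude d (root_density d q w (Suc n) \<tau> i))"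
      using root_density_Suc[OF Suc.prems _ w w0] q by (intro sum.cong) auto
    finally show ?case .
  qed
qed

lemma root_prob_near_uniform:
  fixes V :: "nat \<Rightarrow> real" and \<alpha> :: real
  assumes q: "q \<ge> 2" and d: "d \<ge> 12000 * q\<^sup>2" and \<alpha>: "0 < \<alpha>" "\<alpha> \<le> 1"
    and V0: "V 0 = 1 - 1 / q" and V: "\<And>n. 0 \<le> V n" "\<And>n. V n \<le> 1 - 1 / q"
    and step: "\<And>n. (real d - 1) / (((real d)\<^sup>2 - 1 + \<alpha>) / (\<alpha> * real d) - (1 - V n)) * V n \<le> V (Suc n)"
    and n: "n \<ge> 1" and \<tau>: "\<tau> \<in> colourings (leaves d n) q" and i: "i \<in> {1..q}"
  shows "\<bar>root_prob d q (1 - \<alpha> * real q / real (d + 1)) n \<tau> i - 1 / q\<bar> \<le> 6 * sqrt (V n)"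
proof -
  define w where "w = 1 - \<alpha> * real q / real (d + 1)"
  have \<tau>': "\<tau> \<in> colourings (top_words d n) q" using \<tau> unfolding leaves_eq[OF n] top_words_def .
  note bounds = amplitude_root_density_ge[OF q d \<alpha> w_def V0 V step \<tau>']
  have q1: "q \<ge> 1" using q by simp
  have "1 \<le> q\<^sup>2" using q by simp
  then have d2: "d \<ge> 2" using d by linarith
  have "V n \<le> 1" using V(2)[of n] by (smt (verit) divide_nonneg_nonneg of_nat_0_le_iff)
  then have "\<bar>root_density d q w n \<tau> i - 1\<bar> \<le> 6 * card {1..q} * sqrt (V n)"
    using bounds(2) i V(1)
    by (intro density_near_one[OF _ _ density_root_density[OF \<tau>' q1 bounds(1)] d2]) auto
  moreover have "root_prob d q w n \<tau> i - 1 / q = (root_density d q w n \<tau> i - 1) / q"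
    unfolding root_prob_eq[OF n q1 bounds(1)] root_density_def using q by (simp add: diff_divide_distrib)
  ultimately show ?thesis unfolding w_def[symmetric] using q by (simp add: abs_divide field_simps)
qed

theorem theorem2p1:
  fixes q :: nat
  assumes "q \<ge> 3"
  shows "\<exists>(C::real) (d0::nat). C > 0 \<and> d0 > 0 \<and>
    (\<forall>d\<ge>d0. \<forall>\<alpha>\<in>{0<..<1::real}. \<forall>i\<in>{1..q}.
       (\<lambda>n. Max ((\<lambda>\<tau>. \<bar>root_prob d q (max 0 (1 - real q / real (d + 1))) n \<tau> i - 1 / real q\<bar>)
                   ` colourings (leaves d n) q)) \<longlonglongrightarrow> 0
     \<and> (\<forall>n\<ge>1. \<forall>\<tau>\<in>colourings (leaves d n) q.
          \<bar>root_prob d q (1 - \<alpha> * real q / real (d + 1)) n \<tau> i - 1 / real q\<bar>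
            \<le> C * \<alpha> powr (real n / 2)))"
proof (intro exI[of _ "6::real"] exI[of _ "12000 * q\<^sup>2"] conjI allI impI ballI)
  show "0 < 12000 * q\<^sup>2" using assms by simp
next
  fix d :: nat and \<alpha> :: real and i
  assume d: "12000 * q\<^sup>2 \<le> d" and i: "i \<in> {1..q}"
  have q2: "2 \<le> q" using assms by simp
  have "q \<le> q\<^sup>2" by (simp add: power2_eq_square)
  then have qd: "q \<le> d" and d3: "d \<ge> 3" using d assms by linarith+
  \<comment> \<open>the solution of \<open>1 / V (n + 1) = 1 / V n + 1 / (d - 1)\<close>\<close>
  define V where "V n = 1 / (q / (real q - 1) + n / (real d - 1))" for n :: nat
  have Vden: "q / (real q - 1) > 0" "n / (real d - 1) \<ge> 0" for n :: nat using assms d3 by auto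
  have wc: "max 0 (1 - real q / real (d + 1)) = 1 - 1 * real q / real (d + 1)" using qd by (simp add: max_def field_simps)
  have bound: "\<bar>root_prob d q (max 0 (1 - real q / real (d + 1))) n \<tau> i - 1 / q\<bar> \<le> 6 * sqrt (V n)"
    if "n \<ge> 1" "\<tau> \<in> colourings (leaves d n) q" for n \<tau>
    unfolding wc
  proof (rule root_prob_near_uniform[OF q2 d _ _ _ _ _ _ that i])
    show V0: "V 0 = 1 - 1 / q" using assms by (simp add: V_def field_simps)
    show Vpos: "0 \<le> V n" for n unfolding V_def using Vden(1) Vden(2)[of n] by simp
    show "V n \<le> 1 - 1 / q" for n
      unfolding V0[symmetric] unfolding V_def using Vden(1) Vden(2)[of n] by (intro divide_left_mono mult_pos_pos) auto
    show "(real d - 1) / (((real d)\<^sup>2 - 1 + 1) / (1 * real d) - (1 - V n)) * V n \<le> V (Suc n)" for n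
    proof -
      define a where "a = q / (real q - 1) + n / (real d - 1)"
      have a: "a > 0" unfolding a_def using Vden(1) Vden(2)[of n] by linarith
      have "((real d)\<^sup>2 - 1 + 1) / (1 * real d) - (1 - V n) = real d - 1 + 1 / a"
        using d3 by (simp add: V_def a_def power2_eq_square)
      then have "(real d - 1) / (((real d)\<^sup>2 - 1 + 1) / (1 * real d) - (1 - V n)) * V n
          = (real d - 1) / (real d - 1 + 1 / a) * (1 / a)" by (simp add: V_def a_def)
      also have "\<dots> = 1 / (a + 1 / (real d - 1))"
      proof -
        have "e / (e + 1 / a) * (1 / a) = 1 / (a + 1 / e)" if e: "e > 0" for e
        proof -
          have "e / (e + 1 / a) * (1 / a) = e / (a * (e + 1 / a))" by (simp add: mult.commute)
          also have "a * (e + 1 / a) = a * e + 1" using a by (simp add: distrib_left)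
          also have "a * e + 1 = e * (a + 1 / e)" using e by (simp add: distrib_left mult.commute)
          also have "e / (e * (a + 1 / e)) = 1 / (a + 1 / e)" using e by simp
          finally show ?thesis .
        qed
        then show ?thesis using d3 by simp
      qed
      also have "a + 1 / (real d - 1) = q / (real q - 1) + Suc n / (real d - 1)"
        by (simp add: a_def add_divide_distrib)
      finally show ?thesis by (simp add: V_def)
    qed
  qed auto
  show "(\<lambda>n. Max ((\<lambda>\<tau>. \<bar>root_prob d q (max 0 (1 - real q / real (d + 1))) n \<tau> i - 1 / real q\<bar>)
                   ` colourings (leaves d n) q)) \<longlonglongrightarrow> 0"
  proof (rule tendsto_sandwich[of "\<lambda>_. 0" _ _ "\<lambda>n. 6 * sqrt (V n)"])
    have fin: "finite (colourings (leaves d n) q)" "colourings (leaves d n) q \<noteq> {}" if "n \<ge> 1" for n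
    proof -
      have "leaves d n = top_words d n" unfolding leaves_eq[OF that] top_words_def ..
      then show "finite (colourings (leaves d n) q)" "colourings (leaves d n) q \<noteq> {}"
        using assms by (auto simp: colourings_def PiE_eq_empty_iff intro!: finite_PiE)
    qed
    show "\<forall>\<^sub>F n in sequentially. 0 \<le> Max ((\<lambda>\<tau>. \<bar>root_prob d q (max 0 (1 - real q / real (d + 1))) n \<tau> i - 1 / real q\<bar>)
                   ` colourings (leaves d n) q)"
      using eventually_ge_at_top[of 1]
    proof eventually_elim
      case (elim n)
      then show ?case using fin[OF elim] by (subst Max_ge_iff) auto
    qed
    show "\<forall>\<^sub>F n in sequentially. Max ((\<lambda>\<tau>. \<bar>root_prob d q (max 0 (1 - real q / real (d + 1))) n \<tau> i - 1 / real q\<bar>)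
                   ` colourings (leaves d n) q) \<le> 6 * sqrt (V n)"
      using eventually_ge_at_top[of 1]
    proof eventually_elim
      case (elim n)
      then show ?case using fin[OF elim] bound[OF elim] by (subst Max_le_iff) auto
    qed
    have "filterlim (\<lambda>n. real n * (1 / (real d - 1))) at_top sequentially"
      using d3 by (intro filterlim_at_top_mult_tendsto_pos[OF tendsto_const] filterlim_real_sequentially) auto
    then have "filterlim (\<lambda>n. q / (real q - 1) + real n / (real d - 1)) at_top sequentially"
      by (intro filterlim_tendsto_add_at_top[OF tendsto_const]) simp
    then have "V \<longlonglongrightarrow> 0" unfolding V_def
      by (intro tendsto_divide_0[OF tendsto_const] filterlim_at_top_imp_at_infinity)
    then have "(\<lambda>n. 6 * sqrt (V n)) \<longlonglongrightarrow> 6 * sqrt 0" by (intro tendsto_intros)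
    then show "(\<lambda>n. 6 * sqrt (V n)) \<longlonglongrightarrow> 0" by simp
  qed simp
next
  fix d :: nat and \<alpha> :: real and i n \<tau>
  assume d: "12000 * q\<^sup>2 \<le> d" and \<alpha>: "\<alpha> \<in> {0<..<1}" and i: "i \<in> {1..q}"
    and n: "1 \<le> n" and \<tau>: "\<tau> \<in> colourings (leaves d n) q"
  have q2: "2 \<le> q" using assms by simp
  have "1 \<le> q\<^sup>2" using assms by simp
  then have d3: "real d \<ge> 3" using d by linarith
  define V where "V n = (1 - 1 / q) * \<alpha> ^ n" for n :: nat
  have q01: "0 \<le> 1 - 1 / real q" "1 - 1 / real q \<le> 1" using assms by (auto simp: field_simps)
  have "\<bar>root_prob d q (1 - \<alpha> * real q / real (d + 1)) n \<tau> i - 1 / q\<bar> \<le> 6 * sqrt (V n)"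
  proof (rule root_prob_near_uniform[OF q2 d _ _ _ _ _ _ n \<tau> i])
    show "V 0 = 1 - 1 / q" by (simp add: V_def)
    show V0: "0 \<le> V n" for n unfolding V_def using q01 \<alpha> by auto
    show "V n \<le> 1 - 1 / q" for n
      unfolding V_def using q01 \<alpha> by (intro mult_left_le) (auto simp: power_le_one)
    show "(real d - 1) / (((real d)\<^sup>2 - 1 + \<alpha>) / (\<alpha> * real d) - (1 - V n)) * V n \<le> V (Suc n)" for n
    proof -
      define N where "N = ((real d)\<^sup>2 - 1 + \<alpha>) / (\<alpha> * real d) - (1 - V n)"
      have "(real d - 1) / \<alpha> \<le> ((real d)\<^sup>2 - 1 + \<alpha>) / (\<alpha> * real d) - 1"
      proof -
        have "0 \<le> (1 - \<alpha>) * (real d - 1)" using \<alpha> d3 by simp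
        then have "(real d - 1) * real d \<le> (real d)\<^sup>2 - 1 + \<alpha> - \<alpha> * real d"
          by (simp add: algebra_simps power2_eq_square)
        then have "(real d - 1) * real d / (\<alpha> * real d) \<le> ((real d)\<^sup>2 - 1 + \<alpha> - \<alpha> * real d) / (\<alpha> * real d)"
          using \<alpha> by (intro divide_right_mono) auto
        then show ?thesis using \<alpha> d3 by (simp add: diff_divide_distrib)
      qed
      then have N: "(real d - 1) / \<alpha> \<le> N" unfolding N_def using V0[of n] by linarith
      moreover have "0 < (real d - 1) / \<alpha>" using \<alpha> d3 by simp
      ultimately have "(real d - 1) / N \<le> (real d - 1) / ((real d - 1) / \<alpha>)"
        using d3 by (intro divide_left_mono mult_pos_pos) auto
      also have "\<dots> = \<alpha>" using d3 by simp
      finally have "(real d - 1) / N * V n \<le> \<alpha> * V n" using V0 by (intro mult_right_mono)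
      then show ?thesis by (simp add: N_def V_def mult_ac)
    qed
  qed (use \<alpha> in auto)
  also have "\<dots> \<le> 6 * sqrt (\<alpha> ^ n)"
    unfolding V_def using q01 \<alpha> by (intro mult_left_mono real_sqrt_le_mono mult_left_le_one_le) auto
  also have "sqrt (\<alpha> ^ n) = \<alpha> powr (real n / 2)"
    using \<alpha> by (simp add: powr_half_sqrt[symmetric] powr_powr powr_realpow[symmetric])
  finally show "\<bar>root_prob d q (1 - \<alpha> * real q / real (d + 1)) n \<tau> i - 1 / real q\<bar> \<le> 6 * \<alpha> powr (real n / 2)" .
qed simp

end
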